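(* For every simplex collection $\mathcal S$, every $N\in\mathbb N$ and every $\Phi\in\mathcal F(N)$, the procedure $\mathcal A(\Phi,N,\mathcal S)$ described in the context returns a lower margin $\underline m(\Phi)$ and an upper margin $\overline m(\Phi)$ of $\Phi$ with respect to $\mathcal S$, and these satisfy the second-order property $$\underline m(\Phi)=O'(\tau^2),\qquad \overline m(\Phi)=O'(\tau^2).$$
   Context: Simplexes. Let $n\in\mathbb N=\{1,2,\dots\}$, let $\mathbb X\subset\mathbb R^n$ be a bounded closed set containing the origin, and let $\widetilde{\mathbb X}\subset\mathbb R^n$ be a bounded open set containing $\mathbb X$. A simplex collection $\mathcal S=(\mathbb X_i)_{i\in\mathcal I}$ consists of a finite set $\mathcal I\subset\mathbb N$ and, for each $i\in\mathcal I$, vertices $x_{i,1},\dots,x_{i,n+1}\in\mathbb X$ such that $x_{i,j}-x_{i,n+1}$, $j=1,\dots,n$, are linearly independent; with $x_i(w):=\sum_{j=1}^{n+1}w_jx_{i,j}$ and $\mathbb X_i:=\{x_i(w): w_j\ge 0\ \forall j,\ \sum_{j=1}^{n+1}w_j=1\}$, it is required that $\mathbb X=\bigcup_{i\in\mathcal I}\mathbb X_i$. Its maximum sampling interval is $\tau:=\max_{i,j,j'}\|x_{i,j}-x_{i,j'}\|$. For continuous $\xi:\widetilde{\mathbb X}\to\mathbb R$, the linear interpolation $\xi^{\mathrm I}:\mathbb X\to\mathbb R$ with respect to $\mathcal S$ is given by $\xi^{\mathrm I}(x_i(w)):=\sum_{j}w_j\xi(x_{i,j})$ for all $i$ and all $x_i(w)\in\mathbb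 X_i$ (simplex collections are understood to fit together so that this is well defined). Margins and order. Lower and upper margins of $\xi$ with respect to $\mathcal S$ are any numbers $\underline m(\xi)\ge0$, $\overline m(\xi)\ge 0$ with $-\underline m(\xi)\le \xi(x)-\xi^{\mathrm I}(x)\le\overline m(\xi)$ for all $x\in\mathbb X$ (not unique). For $p\in\mathbb N$, a scalar $m$ depending on $\mathcal S$ satisfies $m=O'(\tau^p)$ if there exist $\bar\tau>0$, $C>0$ such that for every simplex collection with maximum sampling interval $\tau$, $\tau\le\bar\tau$ implies $|m|\le C\tau^p$. Constants. Given margins of $\xi$: $\underline b(\xi):=\min_{i,j}\xi(x_{i,j})-\underline m(\xi)$, $\overline b(\xi):=\max_{i,j}\xi(x_{i,j})+\overline m(\xi)$, and $g(\xi):=\max_{i,j,j'}|\xi(x_{i,j})-\xi(x_{i,j'})|/\tau$. Function classes. Let $T\in\mathbb N$ be a predefined number. "Known" means that the object in question can be identified from the form of the function and given information. For continuous $y:\widetilde{\mathbb X}\to\mathbb R$, $\mathcal H(y)$ is the set of functions $h:\widetilde{\mathbb Y}\to\mathbb R$ such that: (H1) $\widetilde{\mathbb Y}\subseteq\mathbb R$ is an open set containing $\{y(x):x\in\widetilde{\mathbb X}\}$; (H2) $h$ is $C^2$, there are known constants (not depending on $\mathcal S$) with $\underline{\partial}(h)\le h'(\tilde y)\le\overline{\partial}(h)$ for all $\tilde y\in\mathbb Y:=\{y(x):x\in\mathbb X\}$, and for some $C_h>0$, for every simplex collection $\mathcal S$ there are known constants with $\underline{\partial^2}(h)\le h''(\tilde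 y)\le\overline{\partial^2}(h)$ for all $\tilde y\in\mathbb Y^{\mathrm I}:=\{y^{\mathrm I}(x):x\in\mathbb X\}$ and $|\underline{\partial^2}(h)|+|\overline{\partial^2}(h)|<C_h$. $\mathcal F(1)$ is the set of $C^2$ functions $\xi:\widetilde{\mathbb X}\to\mathbb R$ for which there are known constants $\underline{d^2}(\xi)$, $\overline{d^2}(\xi)$ with $\underline{d^2}(\xi)\le \frac{\partial^2}{\partial\chi^2}\xi(x+\chi\nu)\big|_{\chi=0}\le\overline{d^2}(\xi)$ for all $x\in\mathbb X$ and all $\nu\in\mathbb R^n$ with $\|\nu\|=1$. For $N\ge2$, $\mathcal F(N)$ is the set of functions $\Phi:\widetilde{\mathbb X}\to\mathbb R$ for which there are known $\phi_s,\psi_s\in\mathcal F(N-1)$, $s=1,\dots,T$, and $h\in\mathcal H(y)$ with $\Phi(x)=h(y(x))$, $y(x)=\sum_{s=1}^T\phi_s(x)\psi_s(x)$. Procedure $\mathcal A(\Phi,N,\mathcal S)$. The data witnessing membership in the classes (decompositions, functions $h$, and constants) are fixed for each function independently of $\mathcal S$, except that $\underline{\partial^2}(h),\overline{\partial^2}(h)$ may depend on $\mathcal S$ subject to the bound $C_h$. Step 0: for $\xi\in\mathcal F(1)$ set $\underline m(\xi)=\frac{n\tau^2}{8}\max\{0,\overline{d^2}(\xi)\}$, $\overline m(\xi)=\frac{n\tau^2}{8}\max\{0,-\underline{d^2}(\xi)\}$, and compute $\underline b(\xi),\overline b(\xi),g(\xi)$. If $N=1$ return these for $\xi=\Phi$.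 If $N\ge2$: decompose $\Phi=h(y)$, $y=\sum_s\phi_s\psi_s$ as in the definition of $\mathcal F(N)$. For each $\xi\in\{\phi_1,\dots,\phi_T,\psi_1,\dots,\psi_T\}$, obtain $\underline m(\xi),\overline m(\xi),\underline b(\xi),\overline b(\xi),g(\xi)$ by Step 0 if $\xi\in\mathcal F(1)$, and by $\mathcal A(\xi,N-1,\mathcal S)$ otherwise. With $\underline a(\phi,\psi):=\max\{\underline m(\phi)\overline b(\psi),-\overline m(\phi)\underline b(\psi)\}$ and $\overline a(\phi,\psi):=\max\{\overline m(\phi)\overline b(\psi),-\underline m(\phi)\underline b(\psi)\}$, set $$\underline m(y)=\sum_{s=1}^T\big(\underline a(\phi_s,\psi_s)+\underline a(\psi_s,\phi_s)+\tau^2g(\phi_s)g(\psi_s)\big),\quad \overline m(y)=\sum_{s=1}^T\big(\overline a(\phi_s,\psi_s)+\overline a(\psi_s,\phi_s)+\tau^2g(\phi_s)g(\psi_s)\big),$$ $$\underline m(\Phi)=\max\{-\overline m(y)\underline\partial(h),\underline m(y)\overline\partial(h)\}+\tau^2\tfrac{n g(y)^2}{8}\max\{0,\overline{\partial^2}(h)\},$$ $$\overline m(\Phi)=\max\{-\underline m(y)\underline\partial(h),\overline m(y)\overline\partial(h)\}+\tau^2\tfrac{n g(y)^2}{8}\max\{0,-\underline{\partial^2}(h)\},$$ and compute $\underline b(\Phi),\overline b(\Phi),g(\Phi)$; return all of these. *)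

theory Defs
  imports "HOL-Analysis.Analysis"
begin

(* Throughout, functions on a subset of a space are total functions; only their
   values on the intended domain (Xt for the functions on R^n) enter the conditions below. *)

section \<open>Simplex collections and linear interpolation\<close>

(* vert S i j is the vertex x_{i,j}; only i in idx S and j in {1..n+1} are meaningful. *)
record 'a simplex_coll =
  idx :: "nat set"
  vert :: "nat \<Rightarrow> nat \<Rightarrow> 'a"

definition weights :: "nat \<Rightarrow> (nat \<Rightarrow> real) set" where
  "weights m = {w. (\<forall>j\<in>{1..m}. 0 \<le> w j) \<and> (\<Sum>j=1..m. w j) = 1}"

definition pt :: "(real^'n) simplex_coll \<Rightarrow> nat \<Rightarrow> (nat \<Rightarrow> real) \<Rightarrow> real^'n" where
  "pt S i w = (\<Sum>j=1..CARD('n)+1. w j *\<^sub>R vert S i j)"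

definition simplex_of :: "(real^'n) simplex_coll \<Rightarrow> nat \<Rightarrow> (real^'n) set" where
  "simplex_of S i = pt S i ` weights (CARD('n)+1)"

definition interp_val ::
    "(real^'n) simplex_coll \<Rightarrow> (real^'n \<Rightarrow> real) \<Rightarrow> nat \<Rightarrow> (nat \<Rightarrow> real) \<Rightarrow> real" where
  "interp_val S \<xi> i w = (\<Sum>j=1..CARD('n)+1. w j * \<xi> (vert S i j))"

(* The simplexes fit together: the linear interpolation of every continuous function on Xt
   is well defined. *)
definition fits_together :: "(real^'n) set \<Rightarrow> (real^'n) simplex_coll \<Rightarrow> bool" where
  "fits_together Xt S \<longleftrightarrow>
     (\<forall>\<xi>. continuous_on Xt \<xi> \<longrightarrow>
        (\<forall>i\<in>idx S. \<forall>k\<in>idx S. \<forall>w\<in>weights (CARD('n)+1). \<forall>v\<in>weights (CARD('n)+1).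
           pt S i w = pt S k v \<longrightarrow> interp_val S \<xi> i w = interp_val S \<xi> k v))"

definition simplex_collection ::
    "(real^'n) set \<Rightarrow> (real^'n) set \<Rightarrow> (real^'n) simplex_coll \<Rightarrow> bool" where
  "simplex_collection X Xt S \<longleftrightarrow>
     finite (idx S) \<and> 0 \<notin> idx S \<and>
     (\<forall>i\<in>idx S.
        (\<forall>j\<in>{1..CARD('n)+1}. vert S i j \<in> X) \<and>
        inj_on (\<lambda>j. vert S i j - vert S i (CARD('n)+1)) {1..CARD('n)} \<and>
        independent ((\<lambda>j. vert S i j - vert S i (CARD('n)+1)) ` {1..CARD('n)})) \<and>
     X = (\<Union>i\<in>idx S. simplex_of S i) \<and>
     fits_together Xt S"

definition tau :: "(real^'n) simplex_coll \<Rightarrow> real" where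
  "tau S = Max {norm (vert S i j - vert S i j') | i j j'.
                  i \<in> idx S \<and> j \<in> {1..CARD('n)+1} \<and> j' \<in> {1..CARD('n)+1}}"

definition interp :: "(real^'n) simplex_coll \<Rightarrow> (real^'n \<Rightarrow> real) \<Rightarrow> real^'n \<Rightarrow> real" where
  "interp S \<xi> x = (THE r. \<exists>i\<in>idx S. \<exists>w\<in>weights (CARD('n)+1).
                      x = pt S i w \<and> r = interp_val S \<xi> i w)"

lemma interp_pt:
  fixes S :: "(real^'n) simplex_coll"
  assumes "simplex_collection X Xt S" "continuous_on Xt \<xi>"
    and "i \<in> idx S" "w \<in> weights (CARD('n)+1)"
  shows "interp S \<xi> (pt S i w) = interp_val S \<xi> i w"
  unfolding interp_def
proof (rule the_equality)
  show "\<exists>k\<in>idx S. \<exists>v\<in>weights (CARD('n)+1).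
          pt S i w = pt S k v \<and> interp_val S \<xi> i w = interp_val S \<xi> k v"
    using assms by blast
  show "r = interp_val S \<xi> i w"
    if "\<exists>k\<in>idx S. \<exists>v\<in>weights (CARD('n)+1). pt S i w = pt S k v \<and> r = interp_val S \<xi> k v"
    for r
    using that assms unfolding simplex_collection_def fits_together_def by metis
qed


section \<open>Margins and order\<close>

definition margins ::
    "(real^'n) set \<Rightarrow> (real^'n) simplex_coll \<Rightarrow> (real^'n \<Rightarrow> real) \<Rightarrow> real \<Rightarrow> real \<Rightarrow> bool" where
  "margins X S \<xi> ml mu \<longleftrightarrow>
     0 \<le> ml \<and> 0 \<le> mu \<and> (\<forall>x\<in>X. - ml \<le> \<xi> x - interp S \<xi> x \<and> \<xi> x - interp S \<xi> x \<le> mu)"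

definition bigO' ::
    "(real^'n) set \<Rightarrow> (real^'n) set \<Rightarrow> nat \<Rightarrow> ((real^'n) simplex_coll \<Rightarrow> real) \<Rightarrow> bool" where
  "bigO' X Xt p m \<longleftrightarrow>
     (\<exists>taubar>0. \<exists>C>0. \<forall>S. simplex_collection X Xt S \<longrightarrow> tau S \<le> taubar \<longrightarrow>
        \<bar>m S\<bar> \<le> C * tau S ^ p)"

definition b_low :: "(real^'n) simplex_coll \<Rightarrow> (real^'n \<Rightarrow> real) \<Rightarrow> real \<Rightarrow> real" where
  "b_low S \<xi> ml = Min {\<xi> (vert S i j) | i j. i \<in> idx S \<and> j \<in> {1..CARD('n)+1}} - ml"

definition b_up :: "(real^'n) simplex_coll \<Rightarrow> (real^'n \<Rightarrow> real) \<Rightarrow> real \<Rightarrow> real" where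
  "b_up S \<xi> mu = Max {\<xi> (vert S i j) | i j. i \<in> idx S \<and> j \<in> {1..CARD('n)+1}} + mu"

definition g_const :: "(real^'n) simplex_coll \<Rightarrow> (real^'n \<Rightarrow> real) \<Rightarrow> real" where
  "g_const S \<xi> = Max {\<bar>\<xi> (vert S i j) - \<xi> (vert S i j')\<bar> / tau S | i j j'.
                        i \<in> idx S \<and> j \<in> {1..CARD('n)+1} \<and> j' \<in> {1..CARD('n)+1}}"


section \<open>Function classes\<close>

(* Twice continuously (Frechet) differentiable on U; used for open U only. *)
definition C2_on :: "'a::real_normed_vector set \<Rightarrow> ('a \<Rightarrow> real) \<Rightarrow> bool" where
  "C2_on U f \<longleftrightarrow>
     (\<exists>(f' :: 'a \<Rightarrow> 'a \<Rightarrow>\<^sub>L real) (f'' :: 'a \<Rightarrow> 'a \<Rightarrow>\<^sub>L 'a \<Rightarrow>\<^sub>L real).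
        (\<forall>x\<in>U. (f has_derivative blinfun_apply (f' x)) (at x)) \<and>
        (\<forall>x\<in>U. (f' has_derivative blinfun_apply (f'' x)) (at x)) \<and>
        continuous_on U f'')"

(* An outer function h together with its domain and the known bounds on h' and h''.
   Only the bounds on h'' may depend on the simplex collection. *)
record 'a outer =
  hdom :: "real set"
  hfun :: "real \<Rightarrow> real"
  dh_low :: real
  dh_up :: real
  d2h_low :: "'a simplex_coll \<Rightarrow> real"
  d2h_up :: "'a simplex_coll \<Rightarrow> real"

definition H_class ::
    "(real^'n) set \<Rightarrow> (real^'n) set \<Rightarrow> (real^'n \<Rightarrow> real) \<Rightarrow> (real^'n) outer set" where
  "H_class X Xt y = {h.
     open (hdom h) \<and> y ` Xt \<subseteq> hdom h \<and>
     C2_on (hdom h) (hfun h) \<and>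
     (\<forall>t\<in>y ` X. dh_low h \<le> deriv (hfun h) t \<and> deriv (hfun h) t \<le> dh_up h) \<and>
     (\<exists>C>0. \<forall>S. simplex_collection X Xt S \<longrightarrow>
        (\<forall>t\<in>interp S y ` X. d2h_low h S \<le> deriv (deriv (hfun h)) t \<and>
                             deriv (deriv (hfun h)) t \<le> d2h_up h S) \<and>
        \<bar>d2h_low h S\<bar> + \<bar>d2h_up h S\<bar> < C)}"

record 'a decomp =
  phi :: "nat \<Rightarrow> 'a \<Rightarrow> real"
  psi :: "nat \<Rightarrow> 'a \<Rightarrow> real"
  out :: "'a outer"

definition inner_fun :: "nat \<Rightarrow> 'a decomp \<Rightarrow> 'a \<Rightarrow> real" where
  "inner_fun T D x = (\<Sum>s=1..T. phi D s x * psi D s x)"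

(* The classes F(N) refer to data that are "known". What is known is modelled by an arbitrary
   record K: curv K xi are the known bounds on the second directional derivatives of xi (if any),
   dec K N Phi is the known decomposition of Phi witnessing membership in F(N), N >= 2 (if any).
   Nothing is assumed about K; that the data are correct is part of membership in the classes.
   (If mere existence of the bounds were meant, every C^2 function would belong to F(1), because
   X is compact, and the recursion of the procedure would always stop after one step.)
   As K does not depend on a simplex collection, the data are fixed independently of it. *)
record 'a knowledge =
  curv :: "('a \<Rightarrow> real) \<Rightarrow> (real \<times> real) option"
  dec :: "nat \<Rightarrow> ('a \<Rightarrow> real) \<Rightarrow> 'a decomp option"

definition F1_class ::
    "(real^'n) set \<Rightarrow> (real^'n) set \<Rightarrow> (real^'n) knowledge \<Rightarrow> (real^'n \<Rightarrow> real) set" where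
  "F1_class X Xt K = {\<xi>. C2_on Xt \<xi> \<and>
     (\<exists>dl du. curv K \<xi> = Some (dl, du) \<and>
        (\<forall>x\<in>X. \<forall>\<nu>. norm \<nu> = 1 \<longrightarrow>
           dl \<le> deriv (deriv (\<lambda>u. \<xi> (x + u *\<^sub>R \<nu>))) 0 \<and>
           deriv (deriv (\<lambda>u. \<xi> (x + u *\<^sub>R \<nu>))) 0 \<le> du))}"

fun F_class ::
    "(real^'n) set \<Rightarrow> (real^'n) set \<Rightarrow> nat \<Rightarrow> (real^'n) knowledge \<Rightarrow> nat \<Rightarrow> (real^'n \<Rightarrow> real) set"
where
  "F_class X Xt T K 0 = {}"
| "F_class X Xt T K (Suc 0) = F1_class X Xt K"
| "F_class X Xt T K (Suc (Suc N)) = {\<Phi>. \<exists>D. dec K (Suc (Suc N)) \<Phi> = Some D \<and>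
     (\<forall>s\<in>{1..T}. phi D s \<in> F_class X Xt T K (Suc N) \<and> psi D s \<in> F_class X Xt T K (Suc N)) \<and>
     out D \<in> H_class X Xt (inner_fun T D) \<and>
     (\<forall>x\<in>Xt. \<Phi> x = hfun (out D) (inner_fun T D x))}"


section \<open>The procedure\<close>

record result =
  m_low :: real
  m_up :: real
  bnd_low :: real
  bnd_up :: real
  grad :: real

definition mk_result ::
    "(real^'n) simplex_coll \<Rightarrow> (real^'n \<Rightarrow> real) \<Rightarrow> real \<Rightarrow> real \<Rightarrow> result" where
  "mk_result S \<xi> ml mu =
     \<lparr>m_low = ml, m_up = mu, bnd_low = b_low S \<xi> ml, bnd_up = b_up S \<xi> mu, grad = g_const S \<xi>\<rparr>"

definition step0 ::
    "(real^'n) knowledge \<Rightarrow> (real^'n) simplex_coll \<Rightarrow> (real^'n \<Rightarrow> real) \<Rightarrow> result" where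
  "step0 K S \<xi> = (let (dl, du) = the (curv K \<xi>) in
     mk_result S \<xi>
       (real CARD('n) * (tau S)\<^sup>2 / 8 * max 0 du)
       (real CARD('n) * (tau S)\<^sup>2 / 8 * max 0 (- dl)))"

definition a_low :: "result \<Rightarrow> result \<Rightarrow> real" where
  "a_low p q = max (m_low p * bnd_up q) (- (m_up p * bnd_low q))"

definition a_up :: "result \<Rightarrow> result \<Rightarrow> real" where
  "a_up p q = max (m_up p * bnd_up q) (- (m_low p * bnd_low q))"

(* The step for N >= 2; R xi is the result obtained for xi among the phi_s, psi_s. *)
definition compose_step ::
    "nat \<Rightarrow> (real^'n) simplex_coll \<Rightarrow> (real^'n) decomp \<Rightarrow> ((real^'n \<Rightarrow> real) \<Rightarrow> result) \<Rightarrow>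
     (real^'n \<Rightarrow> real) \<Rightarrow> result" where
  "compose_step T S D R \<Phi> = (let
     y = inner_fun T D;
     h = out D;
     myl = (\<Sum>s=1..T. a_low (R (phi D s)) (R (psi D s)) + a_low (R (psi D s)) (R (phi D s))
                       + (tau S)\<^sup>2 * grad (R (phi D s)) * grad (R (psi D s)));
     myu = (\<Sum>s=1..T. a_up (R (phi D s)) (R (psi D s)) + a_up (R (psi D s)) (R (phi D s))
                       + (tau S)\<^sup>2 * grad (R (phi D s)) * grad (R (psi D s)));
     c = (tau S)\<^sup>2 * (real CARD('n) * (g_const S y)\<^sup>2 / 8)
   in mk_result S \<Phi>
        (max (- (myu * dh_low h)) (myl * dh_up h) + c * max 0 (d2h_up h S))
        (max (- (myl * dh_low h)) (myu * dh_up h) + c * max 0 (- d2h_low h S)))"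

fun procA ::
    "(real^'n) set \<Rightarrow> (real^'n) set \<Rightarrow> nat \<Rightarrow> (real^'n) knowledge \<Rightarrow>
     (real^'n \<Rightarrow> real) \<Rightarrow> nat \<Rightarrow> (real^'n) simplex_coll \<Rightarrow> result"
where
  "procA X Xt T K \<Phi> 0 S = undefined"
| "procA X Xt T K \<Phi> (Suc 0) S = step0 K S \<Phi>"
| "procA X Xt T K \<Phi> (Suc (Suc N)) S =
     compose_step T S (the (dec K (Suc (Suc N)) \<Phi>))
       (\<lambda>\<xi>. if \<xi> \<in> F_class X Xt T K 1 then step0 K S \<xi> else procA X Xt T K \<xi> (Suc N) S) \<Phi>"

end

theory Submission
  imports Defs
begin

text \<open>
  The margins are interval-arithmetic bounds for an error that is split into pieces, and every
  piece is of one of three kinds.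

  \<^item> \<^emph>\<open>Curvature.\<close> On one simplex the interpolant at \<open>x = \<Sum> w\<^sub>j p\<^sub>j\<close> is \<open>\<Sum> w\<^sub>j f(p\<^sub>j)\<close>. Expanding
    \<open>f\<close> at \<open>x\<close>, the first-order terms cancel because \<open>\<Sum> w\<^sub>j (p\<^sub>j - x) = 0\<close>, and what remains is at most
    half the curvature times the weighted variance \<open>\<Sum> w\<^sub>j \<parallel>p\<^sub>j - x\<parallel>\<^sup>2\<close>. With \<open>n + 1\<close> nodes at mutual
    distance at most \<open>\<delta>\<close> the variance is at most \<open>n \<delta>\<^sup>2 / 4\<close>; this is the source of the factor
    \<open>n \<delta>\<^sup>2 / 8\<close> (\<open>convex_combination_error\<close>). The lemma is used twice: for the functions with known
    curvature, with the vertices of the simplex as nodes, and for the outer functions \<open>h\<close>, with the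
    numbers \<open>y(x\<^sub>i\<^sub>j)\<close> as nodes, whose spread is at most \<open>\<tau> g(y)\<close>.

  \<^item> \<^emph>\<open>Products.\<close> Writing \<open>\<phi>\<^sup>I\<close> for the interpolant,
    \<open>\<phi>\<psi> - (\<phi>\<psi>)\<^sup>I = (\<phi> - \<phi>\<^sup>I) \<psi> + \<phi>\<^sup>I (\<psi> - \<psi>\<^sup>I) - ((\<phi>\<psi>)\<^sup>I - \<phi>\<^sup>I \<psi>\<^sup>I)\<close>. The first two terms are an error
    in a known interval times a value in a known interval; the last is the covariance of the vertex
    values and is at most \<open>\<tau>\<^sup>2 g(\<phi>) g(\<psi>)\<close> (\<open>margins_product\<close>).

  \<^item> \<^emph>\<open>Composition.\<close> \<open>h(y) - h(y)\<^sup>I = (h(y) - h(y\<^sup>I)) + (h(y\<^sup>I) - h(y)\<^sup>I)\<close>: the mean value theorem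
    turns the first bracket into a slope in a known interval times the error of \<open>y\<close>, and the second
    bracket is the curvature term (\<open>margins_outer\<close>).

  For the order, each margin is assembled by sums and maxima from terms that consist of \<open>\<tau>\<^sup>2\<close>, or a
  margin of a simpler function, times a coefficient bounded independently of the simplex collection. The coefficients are the bounds on the values
  and the difference quotients \<open>g\<close>, so besides validity of the margins the induction on \<open>N\<close> carries
  continuity and a Lipschitz property of the functions (\<open>certified_procA\<close>).
\<close>

section \<open>The interpolation error of a function with bounded curvature\<close>

text \<open>
  A weighted covariance, expressed through pairwise differences only. Taking both families equal and
  centred gives the variance of the nodes of a convex combination; over the reals it gives the
  interpolation defect of a product.
\<close>

lemma covariance_as_pair_sum:
  fixes a b :: "'i \<Rightarrow> 'a::real_inner"
  assumes "finite J" "sum w J = 1"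
  shows "(\<Sum>j\<in>J. w j * (a j \<bullet> b j)) - (\<Sum>j\<in>J. w j *\<^sub>R a j) \<bullet> (\<Sum>j\<in>J. w j *\<^sub>R b j)
       = (\<Sum>j\<in>J. \<Sum>k\<in>J. w j * w k * ((a j - a k) \<bullet> (b j - b k))) / 2"
proof -
  let ?D = "\<Sum>j\<in>J. w j * (a j \<bullet> b j)"
  let ?A = "\<Sum>j\<in>J. w j *\<^sub>R a j" and ?B = "\<Sum>j\<in>J. w j *\<^sub>R b j"
  have "(\<Sum>j\<in>J. \<Sum>k\<in>J. w j * w k * ((a j - a k) \<bullet> (b j - b k)))
     = (\<Sum>j\<in>J. \<Sum>k\<in>J. w k * (w j * (a j \<bullet> b j)) + w j * (w k * (a k \<bullet> b k))
          - (w j *\<^sub>R a j) \<bullet> (w k *\<^sub>R b k) - (w k *\<^sub>R a k) \<bullet> (w j *\<^sub>R b j))"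
    by (intro sum.cong refl) (simp add: algebra_simps)
  also have "\<dots> = sum w J * ?D + sum w J * ?D - ?A \<bullet> ?B - ?A \<bullet> ?B"
  proof -
    have 1: "(\<Sum>j\<in>J. \<Sum>k\<in>J. w k * (w j * (a j \<bullet> b j))) = sum w J * ?D"
      by (subst sum.swap) (simp add: sum_product)
    have 2: "(\<Sum>j\<in>J. \<Sum>k\<in>J. w j * (w k * (a k \<bullet> b k))) = sum w J * ?D"
      by (simp add: sum_product)
    have 3: "(\<Sum>j\<in>J. \<Sum>k\<in>J. (w j *\<^sub>R a j) \<bullet> (w k *\<^sub>R b k)) = ?A \<bullet> ?B"
      unfolding inner_sum_left unfolding inner_sum_right ..
    have 4: "(\<Sum>j\<in>J. \<Sum>k\<in>J. (w k *\<^sub>R a k) \<bullet> (w j *\<^sub>R b j)) = ?A \<bullet> ?B"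
      unfolding inner_sum_right unfolding inner_sum_left ..
    show ?thesis
      by (simp only: sum_subtractf sum.distrib 1 2 3 4)
  qed
  finally show ?thesis using assms by simp
qed

text \<open>
  In the pair sum for the variance the diagonal vanishes, which leaves
  \<open>\<delta>\<^sup>2 (1 - \<Sum> w\<^sub>j\<^sup>2) / 2\<close>. The exact worst case is \<open>\<delta>\<^sup>2 n / (2 (n + 1))\<close>, for equal weights and
  equidistant nodes; the bound below is the simpler one that appears in the margins.
\<close>

lemma weighted_spread_le:
  fixes p :: "'i \<Rightarrow> 'a::real_inner"
  assumes J: "finite J" "card J = Suc n" "n \<ge> 1"
    and w: "\<And>j. j \<in> J \<Longrightarrow> 0 \<le> w j" "sum w J = 1"
    and \<delta>: "\<And>j k. j \<in> J \<Longrightarrow> k \<in> J \<Longrightarrow> norm (p j - p k) \<le> \<delta>"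
  shows "(\<Sum>j\<in>J. w j * (norm (p j - (\<Sum>k\<in>J. w k *\<^sub>R p k)))\<^sup>2) \<le> real n * \<delta>\<^sup>2 / 4"
proof -
  define x where "x = (\<Sum>k\<in>J. w k *\<^sub>R p k)"
  have centred: "(\<Sum>j\<in>J. w j *\<^sub>R (p j - x)) = 0"
    using w(2) by (simp add: scaleR_diff_right sum_subtractf x_def flip: scaleR_left.sum)
  have "(\<Sum>j\<in>J. w j * (norm (p j - x))\<^sup>2)
      = (\<Sum>j\<in>J. \<Sum>k\<in>J. w j * w k * (norm (p j - p k))\<^sup>2) / 2"
    using covariance_as_pair_sum[OF J(1) w(2), of "\<lambda>j. p j - x" "\<lambda>j. p j - x"] centred
    by (simp add: power2_norm_eq_inner)
  also have "\<dots> \<le> (\<Sum>j\<in>J. \<Sum>k\<in>J. (if k = j then 0 else w j * w k * \<delta>\<^sup>2)) / 2"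
    using w(1) \<delta> by (intro divide_right_mono sum_mono) (auto intro!: mult_left_mono power_mono)
  also have "(\<Sum>j\<in>J. \<Sum>k\<in>J. (if k = j then 0 else w j * w k * \<delta>\<^sup>2))
      = (\<Sum>j\<in>J. (w j - (w j)\<^sup>2) * \<delta>\<^sup>2)"
  proof (intro sum.cong refl)
    fix j assume j: "j \<in> J"
    have "(\<Sum>k\<in>J. (if k = j then 0 else w j * w k * \<delta>\<^sup>2))
        = (\<Sum>k\<in>J. w j * \<delta>\<^sup>2 * w k - (if k = j then w j * w j * \<delta>\<^sup>2 else 0))"
      by (intro sum.cong) auto
    also have "\<dots> = w j * \<delta>\<^sup>2 * sum w J - w j * w j * \<delta>\<^sup>2"
      using j J(1) by (simp add: sum_subtractf sum_distrib_left)
    finally show "(\<Sum>k\<in>J. (if k = j then 0 else w j * w k * \<delta>\<^sup>2)) = (w j - (w j)\<^sup>2) * \<delta>\<^sup>2"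
      using w(2) by (simp add: algebra_simps power2_eq_square)
  qed
  also have "\<dots> = (1 - (\<Sum>j\<in>J. (w j)\<^sup>2)) * \<delta>\<^sup>2"
    using w(2) by (simp add: sum_subtractf flip: sum_distrib_right)
  also have "\<dots> \<le> real n / 2 * \<delta>\<^sup>2"
  proof (intro mult_right_mono)
    \<comment> \<open>Cauchy--Schwarz gives \<open>\<Sum> w\<^sub>j\<^sup>2 \<ge> 1/(n+1)\<close>, and \<open>1 - 1/(n+1) \<le> n/2\<close> because \<open>n \<ge> 1\<close>.\<close>
    have "1 \<le> (\<Sum>j\<in>J. (w j)\<^sup>2) * (real n + 1)"
      using sum_squared_le_sum_of_squares[of w J] w(2) J(2) by (simp add: add.commute)
    then have "1 / (real n + 1) \<le> (\<Sum>j\<in>J. (w j)\<^sup>2)"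
      by (simp add: divide_le_eq)
    moreover have "1 - 1 / (real n + 1) \<le> real n / 2"
    proof -
      have "1 - 1 / (real n + 1) = real n / (real n + 1)" by (simp add: field_simps)
      also have "\<dots> \<le> real n / 2" using J(3) by (intro divide_left_mono) auto
      finally show ?thesis .
    qed
    ultimately show "1 - (\<Sum>j\<in>J. (w j)\<^sup>2) \<le> real n / 2" by linarith
  qed simp
  finally show ?thesis by (simp add: x_def)
qed

text \<open>
  The one-dimensional Taylor formula with Lagrange remainder, applied to \<open>t \<mapsto> f (x + t (p - x))\<close>.
\<close>

lemma taylor_upper_on_segment:
  fixes f :: "'a::real_normed_vector \<Rightarrow> real"
  assumes f': "\<And>z. z \<in> closed_segment x p \<Longrightarrow> (f has_derivative blinfun_apply (f' z)) (at z)"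
    and f'': "\<And>z. z \<in> closed_segment x p \<Longrightarrow> (f' has_derivative blinfun_apply (f'' z)) (at z)"
    and M: "\<And>z. z \<in> closed_segment x p \<Longrightarrow> f'' z (p - x) (p - x) \<le> M"
  shows "f p \<le> f x + f' x (p - x) + M / 2"
proof -
  define v where "v = p - x"
  define \<gamma> where "\<gamma> t = x + t *\<^sub>R v" for t
  have \<gamma>: "\<gamma> t \<in> closed_segment x p" if "0 \<le> t" "t \<le> 1" for t
    unfolding in_segment(1) using that
    by (intro exI[of _ t]) (simp add: \<gamma>_def v_def algebra_simps)
  have d\<gamma>: "(\<gamma> has_derivative (\<lambda>h. h *\<^sub>R v)) (at t)" for t
    unfolding \<gamma>_def by (auto intro!: derivative_eq_intros)
  define diff where "diff m = (if m = 0 then f \<circ> \<gamma> else if m = 1 then \<lambda>t. f' (\<gamma> t) v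
      else (\<lambda>t. f'' (\<gamma> t) v v))" for m :: nat
  have D0: "(f \<circ> \<gamma> has_real_derivative f' (\<gamma> t) v) (at t)" if "0 \<le> t" "t \<le> 1" for t
  proof -
    have "(f \<circ> \<gamma> has_derivative f' (\<gamma> t) \<circ> (\<lambda>h. h *\<^sub>R v)) (at t)"
      by (intro diff_chain_at d\<gamma> f' \<gamma> that)
    then show ?thesis
      by (simp add: has_field_derivative_def o_def blinfun.scaleR_right mult_commute_abs)
  qed
  have D1: "((\<lambda>t. f' (\<gamma> t) v) has_real_derivative f'' (\<gamma> t) v v) (at t)"
    if "0 \<le> t" "t \<le> 1" for t
  proof -
    have "(f' \<circ> \<gamma> has_derivative f'' (\<gamma> t) \<circ> (\<lambda>h. h *\<^sub>R v)) (at t)"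
      by (intro diff_chain_at d\<gamma> f'' \<gamma> that)
    from bounded_linear.has_derivative[OF blinfun.bounded_linear_left this, of v]
    show ?thesis
      by (simp add: has_field_derivative_def o_def blinfun.scaleR_right blinfun.scaleR_left
          mult_commute_abs)
  qed
  have "\<exists>t>0. t < 1 \<and> (f \<circ> \<gamma>) 1 =
      (\<Sum>m<2. (diff m 0 / fact m) * (1 - 0)^m) + (diff 2 t / fact 2) * (1 - 0)\<^sup>2"
  proof (rule Taylor_up[where a = 0])
    show "\<forall>m t. m < 2 \<and> 0 \<le> t \<and> t \<le> 1 \<longrightarrow> DERIV (diff m) t :> diff (Suc m) t"
      using D0 D1 by (auto simp: diff_def less_Suc_eq numeral_2_eq_2)
  qed (auto simp: diff_def)
  then obtain t where t: "0 < t" "t < 1" and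
    eq: "f (\<gamma> 1) = f (\<gamma> 0) + f' (\<gamma> 0) v + f'' (\<gamma> t) v v / 2"
    by (auto simp: diff_def numeral_2_eq_2)
  moreover have "f'' (\<gamma> t) v v \<le> M" using M[OF \<gamma>] t by (simp add: v_def)
  ultimately show ?thesis by (simp add: \<gamma>_def v_def)
qed

text \<open>
  The expansion point is the convex combination itself, so that the gradient terms add up to \<open>0\<close>
  and only the variance of the nodes is left.
\<close>

lemma convex_combination_error_upper:
  fixes f :: "'a::real_inner \<Rightarrow> real"
  assumes J: "finite J" "card J = Suc n" "n \<ge> 1"
    and w: "\<And>j. j \<in> J \<Longrightarrow> 0 \<le> w j" "sum w J = 1"
    and \<delta>: "\<And>j k. j \<in> J \<Longrightarrow> k \<in> J \<Longrightarrow> norm (p j - p k) \<le> \<delta>"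
    and Z: "convex Z" "\<And>j. j \<in> J \<Longrightarrow> p j \<in> Z"
    and f': "\<And>z. z \<in> Z \<Longrightarrow> (f has_derivative blinfun_apply (f' z)) (at z)"
    and f'': "\<And>z. z \<in> Z \<Longrightarrow> (f' has_derivative blinfun_apply (f'' z)) (at z)"
    and D: "0 \<le> D" "\<And>z v. z \<in> Z \<Longrightarrow> f'' z v v \<le> D * (norm v)\<^sup>2"
  shows "(\<Sum>j\<in>J. w j * f (p j)) - f (\<Sum>j\<in>J. w j *\<^sub>R p j) \<le> real n * \<delta>\<^sup>2 / 8 * D"
proof -
  define x where "x = (\<Sum>j\<in>J. w j *\<^sub>R p j)"
  have xZ: "x \<in> Z" unfolding x_def by (intro convex_sum J Z w)
  have "(\<Sum>j\<in>J. w j * f (p j))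
      \<le> (\<Sum>j\<in>J. w j * (f x + f' x (p j - x) + D * (norm (p j - x))\<^sup>2 / 2))"
  proof (intro sum_mono mult_left_mono w)
    fix j assume "j \<in> J"
    then have "closed_segment x (p j) \<subseteq> Z" by (intro closed_segment_subset Z xZ)
    then show "f (p j) \<le> f x + f' x (p j - x) + D * (norm (p j - x))\<^sup>2 / 2"
      using f' f'' D(2) by (intro taylor_upper_on_segment) blast+
  qed
  also have "\<dots> = sum w J * f x + f' x (\<Sum>j\<in>J. w j *\<^sub>R (p j - x))
      + D / 2 * (\<Sum>j\<in>J. w j * (norm (p j - x))\<^sup>2)"
    by (simp add: distrib_left sum.distrib blinfun.sum_right blinfun.scaleR_right
        sum_distrib_left sum_distrib_right mult_ac)
  also have "(\<Sum>j\<in>J. w j *\<^sub>R (p j - x)) = 0"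
    using w(2) by (simp add: scaleR_diff_right sum_subtractf x_def flip: scaleR_left.sum)
  finally have "(\<Sum>j\<in>J. w j * f (p j)) - f x
      \<le> D / 2 * (\<Sum>j\<in>J. w j * (norm (p j - x))\<^sup>2)"
    using w(2) by simp
  also have "\<dots> \<le> D / 2 * (real n * \<delta>\<^sup>2 / 4)"
    unfolding x_def using D(1) by (intro mult_left_mono weighted_spread_le J w \<delta>) auto
  finally show ?thesis by (simp add: x_def mult_ac)
qed

lemma deriv_deriv_eq:
  fixes g :: "real \<Rightarrow> real"
  assumes "open V" "t \<in> V"
    and g': "\<And>u. u \<in> V \<Longrightarrow> (g has_real_derivative g' u) (at u)"
    and g'': "(g' has_real_derivative m) (at t)"
  shows "deriv (deriv g) t = m"
proof -
  have "deriv (deriv g) t = deriv g' t"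
    using assms by (intro deriv_cong_ev refl eventually_mono[OF eventually_nhds_in_open[of V t]])
      (auto intro: DERIV_imp_deriv)
  then show ?thesis using g'' by (simp add: DERIV_imp_deriv)
qed

text \<open>
  Links the iterated one-dimensional derivative, in which curvature bounds are given, to the second
  Frechet derivative, which the Taylor estimate needs for directions of any length.
\<close>

lemma second_directional_derivative:
  fixes f :: "'a::real_normed_vector \<Rightarrow> real"
  assumes "open U" "x \<in> U"
    and f': "\<And>z. z \<in> U \<Longrightarrow> (f has_derivative blinfun_apply (f' z)) (at z)"
    and f'': "\<And>z. z \<in> U \<Longrightarrow> (f' has_derivative blinfun_apply (f'' z)) (at z)"
  shows "deriv (deriv (\<lambda>u. f (x + u *\<^sub>R \<nu>))) 0 = f'' x \<nu> \<nu>"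
proof (rule deriv_deriv_eq)
  define \<gamma> where "\<gamma> u = x + u *\<^sub>R \<nu>" for u
  have "continuous_on UNIV \<gamma>" unfolding \<gamma>_def by (intro continuous_intros)
  then show "open (\<gamma> -` U)" using \<open>open U\<close> by (rule open_vimage[rotated])
  show "0 \<in> \<gamma> -` U" using assms(2) by (simp add: \<gamma>_def)
  have d\<gamma>: "(\<gamma> has_derivative (\<lambda>h. h *\<^sub>R \<nu>)) (at u)" for u
    unfolding \<gamma>_def by (auto intro!: derivative_eq_intros)
  show "((\<lambda>u. f (x + u *\<^sub>R \<nu>)) has_real_derivative f' (x + u *\<^sub>R \<nu>) \<nu>) (at u)"
    if "u \<in> \<gamma> -` U" for u
    using diff_chain_at[OF d\<gamma> f', of u] that
    by (simp add: has_field_derivative_def o_def blinfun.scaleR_right mult_commute_abs \<gamma>_def)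
  have "(f' \<circ> \<gamma> has_derivative f'' (\<gamma> 0) \<circ> (\<lambda>h. h *\<^sub>R \<nu>)) (at 0)"
    using assms(2) by (intro diff_chain_at d\<gamma> f'') (simp add: \<gamma>_def)
  from bounded_linear.has_derivative[OF blinfun.bounded_linear_left this, of \<nu>]
  show "((\<lambda>u. f' (x + u *\<^sub>R \<nu>) \<nu>) has_real_derivative f'' x \<nu> \<nu>) (at 0)"
    by (simp add: has_field_derivative_def o_def blinfun.scaleR_right blinfun.scaleR_left
        mult_commute_abs \<gamma>_def)
qed

text \<open>
  The two bounds are one estimate, applied to \<open>f\<close> and to \<open>-f\<close>. The curvature bounds enter through
  \<open>max 0\<close> because the estimate multiplies them by a variance that may be as small as \<open>0\<close>.
\<close>

lemma convex_combination_error: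
  fixes f :: "'a::real_inner \<Rightarrow> real"
  assumes J: "finite J" "card J = Suc n" "n \<ge> 1"
    and w: "\<And>j. j \<in> J \<Longrightarrow> 0 \<le> w j" "sum w J = 1"
    and \<delta>: "\<And>j k. j \<in> J \<Longrightarrow> k \<in> J \<Longrightarrow> norm (p j - p k) \<le> \<delta>"
    and Z: "convex Z" "Z \<subseteq> U" "\<And>j. j \<in> J \<Longrightarrow> p j \<in> Z"
    and U: "open U" "C2_on U f"
    and curv: "\<And>z \<nu>. z \<in> Z \<Longrightarrow> norm \<nu> = 1 \<Longrightarrow> dl \<le> deriv (deriv (\<lambda>u. f (z + u *\<^sub>R \<nu>))) 0"
      "\<And>z \<nu>. z \<in> Z \<Longrightarrow> norm \<nu> = 1 \<Longrightarrow> deriv (deriv (\<lambda>u. f (z + u *\<^sub>R \<nu>))) 0 \<le> du"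
  shows "- (real n * \<delta>\<^sup>2 / 8 * max 0 du) \<le> f (\<Sum>j\<in>J. w j *\<^sub>R p j) - (\<Sum>j\<in>J. w j * f (p j))"
    and "f (\<Sum>j\<in>J. w j *\<^sub>R p j) - (\<Sum>j\<in>J. w j * f (p j)) \<le> real n * \<delta>\<^sup>2 / 8 * max 0 (- dl)"
proof -
  obtain f' f'' where f': "\<And>z. z \<in> U \<Longrightarrow> (f has_derivative blinfun_apply (f' z)) (at z)"
    and f'': "\<And>z. z \<in> U \<Longrightarrow> (f' has_derivative blinfun_apply (f'' z)) (at z)"
    using U(2) unfolding C2_on_def by blast
  have scale: "f'' z v v = (norm v)\<^sup>2 * f'' z (v /\<^sub>R norm v) (v /\<^sub>R norm v)" if "v \<noteq> 0" for z v
    using that by (simp add: blinfun.scaleR_left blinfun.scaleR_right power2_eq_square field_simps)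
  have unit: "dl \<le> f'' z (v /\<^sub>R norm v) (v /\<^sub>R norm v) \<and> f'' z (v /\<^sub>R norm v) (v /\<^sub>R norm v) \<le> du"
    if "z \<in> Z" "v \<noteq> 0" for z v
    using curv[OF that(1), of "v /\<^sub>R norm v"] that Z(2)
      second_directional_derivative[OF U(1) _ f' f'', of z "v /\<^sub>R norm v"] by auto
  have up: "f'' z v v \<le> max 0 du * (norm v)\<^sup>2" if "z \<in> Z" for z v
  proof (cases "v = 0")
    case False
    then show ?thesis unfolding scale[OF False] using unit[OF that False]
      by (subst mult.commute) (auto intro!: mult_right_mono)
  qed auto
  have lo: "(- f'' z) v v \<le> max 0 (- dl) * (norm v)\<^sup>2" if "z \<in> Z" for z v
  proof (cases "v = 0")
    case False
    have "(norm v)\<^sup>2 * (- f'' z (v /\<^sub>R norm v) (v /\<^sub>R norm v)) \<le> (norm v)\<^sup>2 * max 0 (- dl)"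
      using unit[OF that False] by (intro mult_left_mono) auto
    then show ?thesis using scale[OF False, of z] by (simp add: blinfun.minus_left mult_ac)
  qed (auto simp: blinfun.minus_left)
  have "(\<Sum>j\<in>J. w j * f (p j)) - f (\<Sum>j\<in>J. w j *\<^sub>R p j) \<le> real n * \<delta>\<^sup>2 / 8 * max 0 du"
    using f' f'' Z up by (intro convex_combination_error_upper J w \<delta>) auto
  then show "- (real n * \<delta>\<^sup>2 / 8 * max 0 du) \<le> f (\<Sum>j\<in>J. w j *\<^sub>R p j) - (\<Sum>j\<in>J. w j * f (p j))"
    by linarith
  have "(\<Sum>j\<in>J. w j * (- f (p j))) - (- f (\<Sum>j\<in>J. w j *\<^sub>R p j)) \<le> real n * \<delta>\<^sup>2 / 8 * max 0 (- dl)"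
  proof (rule convex_combination_error_upper[where Z = Z and f' = "\<lambda>z. - f' z" and f'' = "\<lambda>z. - f'' z"])
    show "((\<lambda>z. - f z) has_derivative blinfun_apply (- f' z)) (at z)" if "z \<in> Z" for z
      using has_derivative_minus[OF f'] that Z(2) by (auto simp: blinfun.minus_left[abs_def])
    show "((\<lambda>z. - f' z) has_derivative blinfun_apply (- f'' z)) (at z)" if "z \<in> Z" for z
      using has_derivative_minus[OF f''] that Z(2) by (auto simp: blinfun.minus_left[abs_def])
  qed (use J w \<delta> Z lo in auto)
  then show "f (\<Sum>j\<in>J. w j *\<^sub>R p j) - (\<Sum>j\<in>J. w j * f (p j)) \<le> real n * \<delta>\<^sup>2 / 8 * max 0 (- dl)"
    by (simp add: sum_negf)
qed

section \<open>Simplexes, vertices and interpolated values\<close>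

lemma finite_triple_image:
  assumes "finite I" "finite J"
  shows "finite {F i j k | i j k. i \<in> I \<and> j \<in> J \<and> k \<in> J}"
proof -
  have "{F i j k | i j k. i \<in> I \<and> j \<in> J \<and> k \<in> J} = (\<lambda>(i, j, k). F i j k) ` (I \<times> J \<times> J)"
    by force
  then show ?thesis using assms by simp
qed

lemma finite_pair_image:
  assumes "finite I" "finite J"
  shows "finite {F i j | i j. i \<in> I \<and> j \<in> J}"
  using assms by (rule finite_image_set2[of "\<lambda>i. i \<in> I" "\<lambda>j. j \<in> J", simplified])

lemma Max_triple_le_iff:
  fixes F :: "'i \<Rightarrow> 'j \<Rightarrow> 'j \<Rightarrow> real"
  assumes "finite I" "finite J" "I \<noteq> {}" "J \<noteq> {}"
  shows "Max {F i j k | i j k. i \<in> I \<and> j \<in> J \<and> k \<in> J} \<le> c \<longleftrightarrow> (\<forall>i\<in>I. \<forall>j\<in>J. \<forall>k\<in>J. F i j k \<le> c)"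
proof -
  have "{F i j k | i j k. i \<in> I \<and> j \<in> J \<and> k \<in> J} \<noteq> {}" using assms(3,4) by blast
  then show ?thesis
    by (subst Max_le_iff) (use assms in \<open>auto intro!: finite_triple_image\<close>)
qed

lemma le_Max_triple:
  fixes F :: "'i \<Rightarrow> 'j \<Rightarrow> 'j \<Rightarrow> real"
  assumes "finite I" "finite J" "i \<in> I" "j \<in> J" "k \<in> J"
  shows "F i j k \<le> Max {F i j k | i j k. i \<in> I \<and> j \<in> J \<and> k \<in> J}"
  using assms by (intro Max_ge finite_triple_image) auto

lemma weightsD:
  assumes "w \<in> weights m"
  shows "\<And>j. j \<in> {1..m} \<Longrightarrow> 0 \<le> w j" "sum w {1..m} = 1"
  using assms by (auto simp: weights_def)

text \<open>
  Serves both for the simplexes in \<open>n\<close>-space and for the interval of values that an interpolant takes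
  on one simplex.
\<close>

lemma convex_weighted_sums:
  fixes p :: "nat \<Rightarrow> 'a::real_vector"
  shows "convex ((\<lambda>w. \<Sum>j=1..m. w j *\<^sub>R p j) ` weights m)"
proof (rule convexI)
  fix x y :: 'a and u v :: real
  assume "x \<in> (\<lambda>w. \<Sum>j=1..m. w j *\<^sub>R p j) ` weights m" "y \<in> (\<lambda>w. \<Sum>j=1..m. w j *\<^sub>R p j) ` weights m"
    and uv: "0 \<le> u" "0 \<le> v" "u + v = 1"
  then obtain a b where a: "a \<in> weights m" "x = (\<Sum>j=1..m. a j *\<^sub>R p j)"
    and b: "b \<in> weights m" "y = (\<Sum>j=1..m. b j *\<^sub>R p j)"
    by blast
  have mem: "(\<lambda>j. u * a j + v * b j) \<in> weights m"
    using weightsD[OF a(1)] weightsD[OF b(1)] uv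
    by (auto simp: weights_def sum.distrib simp flip: sum_distrib_left)
  have eq: "u *\<^sub>R x + v *\<^sub>R y = (\<Sum>j=1..m. (u * a j + v * b j) *\<^sub>R p j)"
    by (simp only: a b scaleR_sum_right scaleR_scaleR scaleR_add_left sum.distrib)
  show "u *\<^sub>R x + v *\<^sub>R y \<in> (\<lambda>w. \<Sum>j=1..m. w j *\<^sub>R p j) ` weights m"
    unfolding eq by (rule imageI[OF mem])
qed

lemma node_in_weighted_sums:
  fixes p :: "nat \<Rightarrow> 'a::real_vector"
  assumes "k \<in> {1..m}"
  shows "p k \<in> (\<lambda>w. \<Sum>j=1..m. w j *\<^sub>R p j) ` weights m"
proof -
  define e where "e j = (if j = k then 1 else 0 :: real)" for j
  have mem: "e \<in> weights m"
    using assms by (auto simp: weights_def e_def)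
  have "(\<Sum>j=1..m. e j *\<^sub>R p j) = (\<Sum>j=1..m. if j = k then p j else 0)"
    unfolding e_def by (intro sum.cong) auto
  then have eq: "p k = (\<Sum>j=1..m. e j *\<^sub>R p j)" using assms by simp
  show ?thesis by (subst eq) (rule imageI[OF mem])
qed

lemma convex_simplex_of: "convex (simplex_of S i)"
  unfolding simplex_of_def pt_def[abs_def] by (rule convex_weighted_sums)

lemma vert_in_simplex_of:
  fixes S :: "(real^'n) simplex_coll"
  assumes "j \<in> {1..CARD('n)+1}"
  shows "vert S i j \<in> simplex_of S i"
  unfolding simplex_of_def pt_def[abs_def] by (rule node_in_weighted_sums[OF assms])

lemma convex_combination_bounds:
  fixes f :: "'i \<Rightarrow> real"
  assumes "sum w J = 1" "\<And>j. j \<in> J \<Longrightarrow> 0 \<le> w j" "\<And>j. j \<in> J \<Longrightarrow> l \<le> f j" "\<And>j. j \<in> J \<Longrightarrow> f j \<le> u"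
  shows "l \<le> (\<Sum>j\<in>J. w j * f j)" "(\<Sum>j\<in>J. w j * f j) \<le> u"
proof -
  have "l = (\<Sum>j\<in>J. w j * l)" "u = (\<Sum>j\<in>J. w j * u)"
    using assms(1) by (simp_all flip: sum_distrib_right)
  then show "l \<le> (\<Sum>j\<in>J. w j * f j)" "(\<Sum>j\<in>J. w j * f j) \<le> u"
    using assms by (metis (mono_tags, lifting) sum_mono mult_left_mono)+
qed

text \<open>
  The hypotheses on the domain that the argument uses; compactness of \<open>X\<close> gives the bounds on
  values, slopes and \<open>\<tau>\<close> that are uniform over all simplex collections.
\<close>

locale sampled_domain =
  fixes X Xt :: "(real^'n) set"
  assumes compact_X: "compact X" and X_nonempty: "X \<noteq> {}"
    and open_Xt: "open Xt" and X_subset: "X \<subseteq> Xt"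
begin

context
  fixes S :: "(real^'n) simplex_coll"
  assumes coll: "simplex_collection X Xt S"
begin

lemma finite_idx: "finite (idx S)"
  and idx_nonempty: "idx S \<noteq> {}"
  and simplex_subset: "i \<in> idx S \<Longrightarrow> simplex_of S i \<subseteq> X"
  using coll X_nonempty unfolding simplex_collection_def by blast+

lemma pt_in_simplex: "w \<in> weights (CARD('n)+1) \<Longrightarrow> pt S i w \<in> simplex_of S i"
  unfolding simplex_of_def by blast

lemma pt_in_X: "i \<in> idx S \<Longrightarrow> w \<in> weights (CARD('n)+1) \<Longrightarrow> pt S i w \<in> X"
  using pt_in_simplex simplex_subset by blast

lemma vert_in_X: "i \<in> idx S \<Longrightarrow> j \<in> {1..CARD('n)+1} \<Longrightarrow> vert S i j \<in> X"
  using vert_in_simplex_of simplex_subset by blast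

lemma point_cases:
  assumes "x \<in> X"
  obtains i w where "i \<in> idx S" "w \<in> weights (CARD('n)+1)" "x = pt S i w"
  using assms coll unfolding simplex_collection_def simplex_of_def by blast

lemma vert_dist_le_tau:
  assumes "i \<in> idx S" "j \<in> {1..CARD('n)+1}" "k \<in> {1..CARD('n)+1}"
  shows "norm (vert S i j - vert S i k) \<le> tau S"
  unfolding tau_def using assms
  by (intro le_Max_triple[where F = "\<lambda>i j k. norm (vert S i j - vert S i k)"] finite_idx) auto

lemma tau_le_diameter: "tau S \<le> diameter X"
  unfolding tau_def using finite_idx idx_nonempty
  by (subst Max_triple_le_iff)
    (auto intro!: diameter_bounded_bound[OF compact_imp_bounded[OF compact_X], unfolded dist_norm] vert_in_X)

text \<open>
  Needed wherever a difference quotient over \<open>\<tau>\<close> is turned back into a difference: the edge vectors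
  are linearly independent, so at least one edge has positive length.
\<close>

lemma tau_pos: "0 < tau S"
proof -
  obtain i where i: "i \<in> idx S" using idx_nonempty by blast
  then have "independent ((\<lambda>j. vert S i j - vert S i (CARD('n)+1)) ` {1..CARD('n)})"
    using coll unfolding simplex_collection_def by blast
  then have "0 \<notin> (\<lambda>j. vert S i j - vert S i (CARD('n)+1)) ` {1..CARD('n)}"
    using dependent_zero by metis
  moreover have "1 \<in> {1..CARD('n)}" by (simp add: Suc_leI)
  ultimately have "vert S i 1 - vert S i (CARD('n)+1) \<noteq> 0" by (metis image_eqI)
  then have "0 < norm (vert S i 1 - vert S i (CARD('n)+1))" by simp
  also have "\<dots> \<le> tau S" using i by (intro vert_dist_le_tau) auto
  finally show ?thesis .
qed

lemma vert_diff_le_grad: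
  assumes "i \<in> idx S" "j \<in> {1..CARD('n)+1}" "k \<in> {1..CARD('n)+1}"
  shows "\<bar>\<xi> (vert S i j) - \<xi> (vert S i k)\<bar> \<le> tau S * g_const S \<xi>"
proof -
  have "\<bar>\<xi> (vert S i j) - \<xi> (vert S i k)\<bar> / tau S \<le> g_const S \<xi>"
    unfolding g_const_def using assms
    by (intro le_Max_triple[where F = "\<lambda>i j k. \<bar>\<xi> (vert S i j) - \<xi> (vert S i k)\<bar> / tau S"] finite_idx) auto
  then show ?thesis using tau_pos by (simp add: divide_le_eq mult.commute)
qed

lemma grad_nonneg: "0 \<le> g_const S \<xi>"
proof -
  obtain i where i: "i \<in> idx S" using idx_nonempty by blast
  have "0 \<le> tau S * g_const S \<xi>" using vert_diff_le_grad[OF i, of 1 1 \<xi>] by simp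
  then show ?thesis using tau_pos by (simp add: zero_le_mult_iff)
qed

lemma interp_as_val:
  assumes "continuous_on Xt \<xi>" "i \<in> idx S" "w \<in> weights (CARD('n)+1)"
  shows "interp S \<xi> (pt S i w) = (\<Sum>j=1..CARD('n)+1. w j * \<xi> (vert S i j))"
  using interp_pt[OF coll] assms by (simp add: interp_val_def del: sum.cl_ivl_Suc)

lemma marginsI:
  assumes "continuous_on Xt \<xi>" "0 \<le> ml" "0 \<le> mu"
    and "\<And>i w. i \<in> idx S \<Longrightarrow> w \<in> weights (CARD('n)+1) \<Longrightarrow>
      - ml \<le> \<xi> (pt S i w) - (\<Sum>j=1..CARD('n)+1. w j * \<xi> (vert S i j)) \<and>
      \<xi> (pt S i w) - (\<Sum>j=1..CARD('n)+1. w j * \<xi> (vert S i j)) \<le> mu"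
  shows "margins X S \<xi> ml mu"
  unfolding margins_def
proof (intro conjI ballI assms(2,3))
  fix x assume "x \<in> X"
  then obtain i w where iw: "i \<in> idx S" "w \<in> weights (CARD('n)+1)" "x = pt S i w"
    by (rule point_cases)
  show "- ml \<le> \<xi> x - interp S \<xi> x" "\<xi> x - interp S \<xi> x \<le> mu"
    unfolding iw(3) interp_as_val[OF assms(1) iw(1,2)] using assms(4)[OF iw(1,2)] by blast+
qed

lemma marginsD:
  assumes "margins X S \<xi> ml mu" "continuous_on Xt \<xi>" "i \<in> idx S" "w \<in> weights (CARD('n)+1)"
  shows "- ml \<le> \<xi> (pt S i w) - (\<Sum>j=1..CARD('n)+1. w j * \<xi> (vert S i j))"
    and "\<xi> (pt S i w) - (\<Sum>j=1..CARD('n)+1. w j * \<xi> (vert S i j)) \<le> mu"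
  using assms(1) pt_in_X[OF assms(3,4)]
  unfolding margins_def interp_as_val[OF assms(2-4), symmetric] by blast+

lemma vert_bounds:
  assumes "i \<in> idx S" "j \<in> {1..CARD('n)+1}"
  shows "b_low S \<xi> ml \<le> \<xi> (vert S i j) - ml" "\<xi> (vert S i j) + mu \<le> b_up S \<xi> mu"
proof -
  let ?V = "{\<xi> (vert S i j) | i j. i \<in> idx S \<and> j \<in> {1..CARD('n)+1}}"
  have "\<xi> (vert S i j) \<in> ?V" "finite ?V"
    using assms by (blast, intro finite_pair_image finite_idx) simp
  then show "b_low S \<xi> ml \<le> \<xi> (vert S i j) - ml" "\<xi> (vert S i j) + mu \<le> b_up S \<xi> mu"
    unfolding b_low_def b_up_def by (simp_all only: Min_le Max_ge diff_right_mono add_right_mono)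
qed

lemma node_value_bounds:
  assumes "i \<in> idx S" "w \<in> weights (CARD('n)+1)"
  shows "b_low S \<xi> ml \<le> (\<Sum>j=1..CARD('n)+1. w j * \<xi> (vert S i j)) - ml"
    and "(\<Sum>j=1..CARD('n)+1. w j * \<xi> (vert S i j)) + mu \<le> b_up S \<xi> mu"
proof -
  have "b_low S \<xi> ml + ml \<le> (\<Sum>j=1..CARD('n)+1. w j * \<xi> (vert S i j))"
    using vert_bounds(1)[OF assms(1), of _ \<xi> ml] weightsD[OF assms(2)]
      vert_bounds(2)[OF assms(1), of _ \<xi> mu]
    by (intro convex_combination_bounds(1)[where u = "b_up S \<xi> mu - mu"]) (auto simp only: le_diff_eq diff_le_eq)
  then show "b_low S \<xi> ml \<le> (\<Sum>j=1..CARD('n)+1. w j * \<xi> (vert S i j)) - ml"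
    by linarith
  have "(\<Sum>j=1..CARD('n)+1. w j * \<xi> (vert S i j)) \<le> b_up S \<xi> mu - mu"
    using vert_bounds(1)[OF assms(1), of _ \<xi> ml] weightsD[OF assms(2)]
      vert_bounds(2)[OF assms(1), of _ \<xi> mu]
    by (intro convex_combination_bounds(2)[where l = "b_low S \<xi> ml + ml"]) (auto simp only: le_diff_eq diff_le_eq)
  then show "(\<Sum>j=1..CARD('n)+1. w j * \<xi> (vert S i j)) + mu \<le> b_up S \<xi> mu"
    by linarith
qed

end

end

section \<open>Margins of products, sums and compositions\<close>

text \<open>
  If \<open>bu < 0\<close>, then \<open>bl < 0\<close> as well, and the second entry of the maximum is the nonnegative one.
\<close>

lemma max_product_nonneg:
  fixes l u bl bu :: real
  assumes "0 \<le> l" "0 \<le> u" "bl \<le> bu"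
  shows "0 \<le> max (u * bu) (- (l * bl))"
proof (cases "0 \<le> bu")
  case True
  then show ?thesis using assms by (simp add: le_max_iff_disj)
next
  case False
  then have "l * bl \<le> 0" using assms by (intro mult_nonneg_nonpos) auto
  then show ?thesis by (simp add: le_max_iff_disj)
qed

text \<open>
  A product is extremal at a corner of the rectangle \<open>[-l, u] \<times> [bl, bu]\<close>. As the first interval contains
  \<open>0\<close>, the corners \<open>(u, bl)\<close> and \<open>(-l, bu)\<close> are dominated, which leaves the two entries of the maximum.
\<close>

lemma product_le_max:
  fixes e v :: real
  assumes "- l \<le> e" "e \<le> u" "0 \<le> l" "0 \<le> u" "bl \<le> v" "v \<le> bu"
  shows "e * v \<le> max (u * bu) (- (l * bl))"
proof (cases "0 \<le> e \<longleftrightarrow> 0 \<le> v")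
  case True
  show ?thesis
  proof (cases "0 \<le> e")
    case True
    then have "e * v \<le> u * bu" using assms \<open>0 \<le> e \<longleftrightarrow> 0 \<le> v\<close> by (intro mult_mono) auto
    then show ?thesis by simp
  next
    case False
    then have "(- e) * (- v) \<le> l * (- bl)"
      using assms \<open>0 \<le> e \<longleftrightarrow> 0 \<le> v\<close> by (intro mult_mono) auto
    then show ?thesis by simp
  qed
next
  case False
  then have "e * v \<le> 0" by (auto simp: mult_le_0_iff)
  also have "0 \<le> max (u * bu) (- (l * bl))" using assms by (intro max_product_nonneg) auto
  finally show ?thesis .
qed

lemma product_ge_max:
  fixes e v :: real
  assumes "- l \<le> e" "e \<le> u" "0 \<le> l" "0 \<le> u" "bl \<le> v" "v \<le> bu"
  shows "- max (l * bu) (- (u * bl)) \<le> e * v"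
  using product_le_max[of u "- e" l bl v bu] assms by simp

lemma C2_on_has_real_derivative:
  assumes "C2_on U h" "z \<in> U"
  shows "(h has_real_derivative deriv h z) (at z)"
proof -
  obtain h' :: "real \<Rightarrow> real \<Rightarrow>\<^sub>L real" where "(h has_derivative blinfun_apply (h' z)) (at z)"
    using assms unfolding C2_on_def by blast
  then have "h differentiable (at z)" by (rule differentiableI)
  then show ?thesis by (simp add: DERIV_deriv_iff_real_differentiable)
qed

lemma second_directional_derivative_real:
  fixes h :: "real \<Rightarrow> real"
  assumes "C2_on U h" "open U" "z \<in> U" "norm \<nu> = 1"
  shows "deriv (deriv (\<lambda>u. h (z + u *\<^sub>R \<nu>))) 0 = deriv (deriv h) z"
proof -
  obtain h' :: "real \<Rightarrow> real \<Rightarrow>\<^sub>L real" and h'' :: "real \<Rightarrow> real \<Rightarrow>\<^sub>L real \<Rightarrow>\<^sub>L real"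
    where h': "\<And>z. z \<in> U \<Longrightarrow> (h has_derivative blinfun_apply (h' z)) (at z)"
    and h'': "\<And>z. z \<in> U \<Longrightarrow> (h' has_derivative blinfun_apply (h'' z)) (at z)"
    using assms(1) unfolding C2_on_def by blast
  have apply_1: "blinfun_apply L x = x * blinfun_apply L 1" for L :: "real \<Rightarrow>\<^sub>L real" and x
    using blinfun.scaleR_right[of L x 1] by simp
  have "deriv (deriv h) z = h'' z 1 1"
  proof (rule deriv_deriv_eq[OF assms(2,3)])
    show "(h has_real_derivative h' t 1) (at t)" if "t \<in> U" for t
    proof -
      have "blinfun_apply (h' t) = (*) (h' t 1)"
        by (rule ext, subst apply_1) (rule mult.commute)
      then show ?thesis using h'[OF that] by (simp add: has_field_derivative_def)
    qed
    show "((\<lambda>t. h' t 1) has_real_derivative h'' z 1 1) (at z)"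
    proof -
      have "(\<lambda>v. blinfun_apply (h'' z v) 1) = (*) (h'' z 1 1)"
      proof
        fix v
        have "h'' z v = v *\<^sub>R h'' z 1"
          using blinfun.scaleR_right[of "h'' z" v 1] by simp
        then show "blinfun_apply (h'' z v) 1 = h'' z 1 1 * v"
          by (simp add: blinfun.scaleR_left)
      qed
      then show ?thesis
        using bounded_linear.has_derivative[OF blinfun.bounded_linear_left h''[OF assms(3)], of 1]
        by (simp add: has_field_derivative_def)
    qed
  qed
  moreover have "deriv (deriv (\<lambda>u. h (z + u *\<^sub>R \<nu>))) 0 = h'' z \<nu> \<nu>"
    using second_directional_derivative[OF assms(2,3) h' h''] by blast
  moreover have "\<nu> = 1 \<or> \<nu> = - 1" using assms(4) by auto
  then have "h'' z \<nu> \<nu> = h'' z 1 1"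
    by (auto simp: blinfun.minus_left blinfun.minus_right)
  ultimately show ?thesis by simp
qed

text \<open>
  The slope bounds of \<open>h\<close> are known on \<open>y ` X\<close> only, hence the hypothesis that this set contains the
  whole segment between the two arguments.
\<close>

lemma outer_mean_value:
  assumes h: "h \<in> H_class X Xt y" and "X \<subseteq> Xt" and seg: "closed_segment s t \<subseteq> y ` X"
  obtains d where "dh_low h \<le> d" "d \<le> dh_up h" "hfun h t - hfun h s = (t - s) * d"
proof -
  have der: "(hfun h has_real_derivative deriv (hfun h) z) (at z)"
    and bnd: "dh_low h \<le> deriv (hfun h) z" "deriv (hfun h) z \<le> dh_up h"
    if "z \<in> closed_segment s t" for z
    using h seg \<open>X \<subseteq> Xt\<close> that unfolding H_class_def
    by (auto intro!: C2_on_has_real_derivative[of "hdom h"])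
  consider "s = t" | "s < t" | "t < s" by linarith
  then show ?thesis
  proof cases
    case 1
    then show ?thesis using bnd[of s] by (intro that[of "deriv (hfun h) s"]) auto
  next
    case 2
    then obtain z where "s < z" "z < t" "hfun h t - hfun h s = (t - s) * deriv (hfun h) z"
      using MVT2[of s t "hfun h" "deriv (hfun h)"] der by (auto simp: closed_segment_eq_real_ivl)
    then show ?thesis using bnd[of z] by (intro that[of "deriv (hfun h) z"]) (auto simp: closed_segment_eq_real_ivl)
  next
    case 3
    then obtain z where "t < z" "z < s" "hfun h s - hfun h t = (s - t) * deriv (hfun h) z"
      using MVT2[of t s "hfun h" "deriv (hfun h)"] der by (auto simp: closed_segment_eq_real_ivl)
    then show ?thesis using bnd[of z] by (intro that[of "deriv (hfun h) z"])
        (auto simp: closed_segment_eq_real_ivl algebra_simps)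
  qed
qed

context sampled_domain
begin

definition valid_result :: "(real^'n) simplex_coll \<Rightarrow> (real^'n \<Rightarrow> real) \<Rightarrow> result \<Rightarrow> bool" where
  "valid_result S \<xi> r \<longleftrightarrow> margins X S \<xi> (m_low r) (m_up r) \<and> r = mk_result S \<xi> (m_low r) (m_up r)"

lemma valid_result_fields:
  assumes "valid_result S \<xi> r"
  shows "0 \<le> m_low r" "0 \<le> m_up r" "bnd_low r = b_low S \<xi> (m_low r)"
    "bnd_up r = b_up S \<xi> (m_up r)" "grad r = g_const S \<xi>"
proof -
  have "r = mk_result S \<xi> (m_low r) (m_up r)" using assms by (simp add: valid_result_def)
  then show "bnd_low r = b_low S \<xi> (m_low r)" "bnd_up r = b_up S \<xi> (m_up r)" "grad r = g_const S \<xi>"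
    unfolding mk_result_def by (metis result.select_convs)+
  show "0 \<le> m_low r" "0 \<le> m_up r"
    using assms by (auto simp: valid_result_def margins_def)
qed

context
  fixes S :: "(real^'n) simplex_coll"
  assumes coll: "simplex_collection X Xt S"
begin

lemma valid_result_bounds:
  assumes r: "valid_result S \<xi> r" and cont: "continuous_on Xt \<xi>"
    and iw: "i \<in> idx S" "w \<in> weights (CARD('n)+1)"
  defines "I \<equiv> (\<Sum>j=1..CARD('n)+1. w j * \<xi> (vert S i j))"
  shows "- m_low r \<le> \<xi> (pt S i w) - I" "\<xi> (pt S i w) - I \<le> m_up r"
    and "bnd_low r \<le> I" "I \<le> bnd_up r" "bnd_low r \<le> \<xi> (pt S i w)" "\<xi> (pt S i w) \<le> bnd_up r"
proof -
  have "margins X S \<xi> (m_low r) (m_up r)" using r by (simp add: valid_result_def)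
  note e = marginsD[OF coll this cont iw, folded I_def]
  note b = node_value_bounds(1)[OF coll iw, of \<xi> "m_low r", folded I_def]
    node_value_bounds(2)[OF coll iw, of \<xi> "m_up r", folded I_def]
  from e b valid_result_fields[OF r]
  show "- m_low r \<le> \<xi> (pt S i w) - I" "\<xi> (pt S i w) - I \<le> m_up r"
    and "bnd_low r \<le> I" "I \<le> bnd_up r" "bnd_low r \<le> \<xi> (pt S i w)" "\<xi> (pt S i w) \<le> bnd_up r"
    by linarith+
qed

text \<open>
  Each factor \<open>\<phi>(x\<^sub>i\<^sub>j) - \<phi>(x\<^sub>i\<^sub>k)\<close> of the pair sum is at most \<open>\<tau> g(\<phi>)\<close>, and the weights \<open>w\<^sub>j w\<^sub>k\<close> sum
  to \<open>1\<close>.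
\<close>

lemma covariance_le_grad:
  assumes iw: "i \<in> idx S" "w \<in> weights (CARD('n)+1)"
  defines "J \<equiv> {1..CARD('n)+1}"
  shows "\<bar>(\<Sum>j\<in>J. w j * (\<phi> (vert S i j) * \<psi> (vert S i j)))
          - (\<Sum>j\<in>J. w j * \<phi> (vert S i j)) * (\<Sum>j\<in>J. w j * \<psi> (vert S i j))\<bar>
      \<le> (tau S)\<^sup>2 * g_const S \<phi> * g_const S \<psi>"
    (is "\<bar>?cov\<bar> \<le> ?B")
proof -
  have w: "sum w J = 1" "\<And>j. j \<in> J \<Longrightarrow> 0 \<le> w j"
    using weightsD[OF iw(2)] by (auto simp: J_def)
  let ?P = "\<lambda>j k. (\<phi> (vert S i j) - \<phi> (vert S i k)) * (\<psi> (vert S i j) - \<psi> (vert S i k))"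
  have B: "0 \<le> ?B" using grad_nonneg[OF coll] by simp
  have P: "\<bar>?P j k\<bar> \<le> ?B" if "j \<in> J" "k \<in> J" for j k
  proof -
    have "\<bar>?P j k\<bar> \<le> (tau S * g_const S \<phi>) * (tau S * g_const S \<psi>)"
      unfolding abs_mult using that vert_diff_le_grad[OF coll iw(1), of j k] grad_nonneg[OF coll]
        tau_pos[OF coll]
      by (intro mult_mono) (auto simp: J_def)
    then show ?thesis by (simp add: power2_eq_square mult_ac)
  qed
  have cov: "?cov = (\<Sum>j\<in>J. \<Sum>k\<in>J. w j * w k * ?P j k) / 2"
    using covariance_as_pair_sum[of J w "\<lambda>j. \<phi> (vert S i j)" "\<lambda>j. \<psi> (vert S i j)"] w(1)
    by (simp add: J_def del: sum.cl_ivl_Suc)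
  have "\<bar>?cov\<bar> = \<bar>\<Sum>j\<in>J. \<Sum>k\<in>J. w j * w k * ?P j k\<bar> / 2"
    unfolding cov by simp
  also have "\<dots> \<le> (\<Sum>j\<in>J. \<Sum>k\<in>J. w j * w k * ?B) / 2"
    using w(2) P
    by (intro divide_right_mono order.trans[OF sum_abs] sum_mono order.trans[OF sum_abs])
      (auto simp: abs_mult intro!: mult_left_mono)
  also have "(\<Sum>j\<in>J. \<Sum>k\<in>J. w j * w k * ?B) = sum w J * sum w J * ?B"
    unfolding sum_product by (simp only: sum_distrib_right)
  finally show ?thesis using w(1) B by simp
qed

text \<open>
  The true value \<open>\<psi>(x)\<close> and the interpolated value \<open>\<phi>\<^sup>I(x)\<close> both lie between the bounds in the results,
  since those are the extremal vertex values widened by the margins. This is what allows the same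
  bounds in both error terms.
\<close>

lemma margins_product:
  assumes \<phi>: "continuous_on Xt \<phi>" "valid_result S \<phi> p"
    and \<psi>: "continuous_on Xt \<psi>" "valid_result S \<psi> q"
  shows "margins X S (\<lambda>x. \<phi> x * \<psi> x)
      (a_low p q + a_low q p + (tau S)\<^sup>2 * grad p * grad q)
      (a_up p q + a_up q p + (tau S)\<^sup>2 * grad p * grad q)"
proof (rule marginsI[OF coll])
  show "continuous_on Xt (\<lambda>x. \<phi> x * \<psi> x)" by (intro continuous_intros \<phi> \<psi>)
  note fp = valid_result_fields[OF \<phi>(2)] and fq = valid_result_fields[OF \<psi>(2)]
  have ord: "bnd_low r \<le> bnd_up r" if "valid_result S \<xi> r" "continuous_on Xt \<xi>" for \<xi> r
  proof -
    obtain x where "x \<in> X" using X_nonempty by blast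
    then obtain i w where iw: "i \<in> idx S" "w \<in> weights (CARD('n)+1)" "x = pt S i w"
      by (rule point_cases[OF coll])
    show ?thesis using valid_result_bounds(3,4)[OF that iw(1,2)] by linarith
  qed
  have nn: "0 \<le> a_low p q" "0 \<le> a_low q p" "0 \<le> a_up p q" "0 \<le> a_up q p"
    unfolding a_low_def a_up_def using fp fq ord[OF \<phi>(2,1)] ord[OF \<psi>(2,1)]
    by (intro max_product_nonneg; simp)+
  have "0 \<le> (tau S)\<^sup>2 * grad p * grad q" using grad_nonneg[OF coll] fp fq by simp
  with nn show "0 \<le> a_low p q + a_low q p + (tau S)\<^sup>2 * grad p * grad q"
    "0 \<le> a_up p q + a_up q p + (tau S)\<^sup>2 * grad p * grad q" by linarith+
  fix i w assume iw: "i \<in> idx S" "w \<in> weights (CARD('n)+1)"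
  define I where "I \<xi> = (\<Sum>j=1..CARD('n)+1. w j * \<xi> (vert S i j))" for \<xi>
  note bp = valid_result_bounds[OF \<phi>(2,1) iw, folded I_def]
    and bq = valid_result_bounds[OF \<psi>(2,1) iw, folded I_def]
  have "- a_low p q \<le> (\<phi> (pt S i w) - I \<phi>) * \<psi> (pt S i w)"
    "(\<phi> (pt S i w) - I \<phi>) * \<psi> (pt S i w) \<le> a_up p q"
    "- a_low q p \<le> (\<psi> (pt S i w) - I \<psi>) * I \<phi>"
    "(\<psi> (pt S i w) - I \<psi>) * I \<phi> \<le> a_up q p"
    unfolding a_low_def a_up_def using bp bq fp fq
    by (intro product_ge_max product_le_max; simp)+
  moreover have "\<bar>I (\<lambda>x. \<phi> x * \<psi> x) - I \<phi> * I \<psi>\<bar> \<le> (tau S)\<^sup>2 * grad p * grad q"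
    unfolding I_def fp(5) fq(5) by (rule covariance_le_grad[OF iw])
  moreover have "\<phi> (pt S i w) * \<psi> (pt S i w) - I (\<lambda>x. \<phi> x * \<psi> x)
      = (\<phi> (pt S i w) - I \<phi>) * \<psi> (pt S i w) + (\<psi> (pt S i w) - I \<psi>) * I \<phi>
        - (I (\<lambda>x. \<phi> x * \<psi> x) - I \<phi> * I \<psi>)"
    by (simp add: algebra_simps)
  ultimately show "- (a_low p q + a_low q p + (tau S)\<^sup>2 * grad p * grad q)
        \<le> \<phi> (pt S i w) * \<psi> (pt S i w) - (\<Sum>j=1..CARD('n)+1. w j * (\<phi> (vert S i j) * \<psi> (vert S i j))) \<and>
      \<phi> (pt S i w) * \<psi> (pt S i w) - (\<Sum>j=1..CARD('n)+1. w j * (\<phi> (vert S i j) * \<psi> (vert S i j)))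
        \<le> a_up p q + a_up q p + (tau S)\<^sup>2 * grad p * grad q"
    unfolding I_def by linarith
qed

lemma margins_sum:
  assumes "\<And>s. s \<in> A \<Longrightarrow> continuous_on Xt (f s)" "\<And>s. s \<in> A \<Longrightarrow> margins X S (f s) (l s) (u s)"
  shows "margins X S (\<lambda>x. \<Sum>s\<in>A. f s x) (\<Sum>s\<in>A. l s) (\<Sum>s\<in>A. u s)"
proof (rule marginsI[OF coll])
  show "continuous_on Xt (\<lambda>x. \<Sum>s\<in>A. f s x)" by (intro continuous_intros assms)
  show "0 \<le> (\<Sum>s\<in>A. l s)" "0 \<le> (\<Sum>s\<in>A. u s)"
    using assms(2) by (auto intro!: sum_nonneg simp: margins_def)
  fix i w assume iw: "i \<in> idx S" "w \<in> weights (CARD('n)+1)"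
  have "(\<Sum>j=1..CARD('n)+1. w j * (\<Sum>s\<in>A. f s (vert S i j)))
      = (\<Sum>s\<in>A. \<Sum>j=1..CARD('n)+1. w j * f s (vert S i j))"
    unfolding sum_distrib_left by (rule sum.swap)
  then have "(\<Sum>s\<in>A. f s (pt S i w)) - (\<Sum>j=1..CARD('n)+1. w j * (\<Sum>s\<in>A. f s (vert S i j)))
      = (\<Sum>s\<in>A. f s (pt S i w) - (\<Sum>j=1..CARD('n)+1. w j * f s (vert S i j)))"
    by (simp only: sum_subtractf)
  moreover have "(\<Sum>s\<in>A. - l s) \<le> (\<Sum>s\<in>A. f s (pt S i w) - (\<Sum>j=1..CARD('n)+1. w j * f s (vert S i j)))"
    by (intro sum_mono marginsD(1)[OF coll assms(2,1) iw])
  moreover have "(\<Sum>s\<in>A. f s (pt S i w) - (\<Sum>j=1..CARD('n)+1. w j * f s (vert S i j))) \<le> (\<Sum>s\<in>A. u s)"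
    by (intro sum_mono marginsD(2)[OF coll assms(2,1) iw])
  ultimately show "- (\<Sum>s\<in>A. l s) \<le> (\<Sum>s\<in>A. f s (pt S i w)) - (\<Sum>j=1..CARD('n)+1. w j * (\<Sum>s\<in>A. f s (vert S i j))) \<and>
      (\<Sum>s\<in>A. f s (pt S i w)) - (\<Sum>j=1..CARD('n)+1. w j * (\<Sum>s\<in>A. f s (vert S i j))) \<le> (\<Sum>s\<in>A. u s)"
    by (simp only: sum_negf)
qed

text \<open>
  Since \<open>X\<close> may be disconnected, so may be \<open>y ` X\<close>, and the mean value theorem cannot be applied
  there directly. On a single simplex, however, \<open>y\<close> has a connected range, which contains the values
  at the vertices, hence the interpolated value, hence the whole segment to the true value.
\<close>

lemma margins_outer:
  assumes y: "continuous_on Xt y" "margins X S y ml mu" and h: "h \<in> H_class X Xt y"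
    and \<Phi>: "continuous_on Xt \<Phi>" "\<And>x. x \<in> Xt \<Longrightarrow> \<Phi> x = hfun h (y x)"
  defines "c \<equiv> (tau S)\<^sup>2 * (real CARD('n) * (g_const S y)\<^sup>2 / 8)"
  shows "margins X S \<Phi> (max (- (mu * dh_low h)) (ml * dh_up h) + c * max 0 (d2h_up h S))
      (max (- (ml * dh_low h)) (mu * dh_up h) + c * max 0 (- d2h_low h S))"
proof (rule marginsI[OF coll \<Phi>(1)])
  have m: "0 \<le> ml" "0 \<le> mu" using y(2) by (auto simp: margins_def)
  obtain x0 where "x0 \<in> X" using X_nonempty by blast
  then have "dh_low h \<le> dh_up h" using h by (fastforce simp: H_class_def)
  then have "0 \<le> max (- (mu * dh_low h)) (ml * dh_up h)" "0 \<le> max (- (ml * dh_low h)) (mu * dh_up h)"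
    using max_product_nonneg[of mu ml] max_product_nonneg[of ml mu] m by (simp_all add: max.commute)
  moreover have "0 \<le> c" by (simp add: c_def)
  ultimately show "0 \<le> max (- (mu * dh_low h)) (ml * dh_up h) + c * max 0 (d2h_up h S)"
    "0 \<le> max (- (ml * dh_low h)) (mu * dh_up h) + c * max 0 (- d2h_low h S)"
    by simp_all
  fix i w assume iw: "i \<in> idx S" "w \<in> weights (CARD('n)+1)"
  define J where "J = {1..CARD('n)+1}"
  define Y where "Y = (\<Sum>j\<in>J. w j * y (vert S i j))"
  have w: "\<And>j. j \<in> J \<Longrightarrow> 0 \<le> w j" "sum w J = 1"
    using weightsD[OF iw(2)] by (auto simp: J_def)
  have sX: "simplex_of S i \<subseteq> X" by (rule simplex_subset[OF coll iw(1)])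
  have conv: "convex (y ` simplex_of S i)"
  proof -
    have "connected (y ` simplex_of S i)"
      using y(1) sX X_subset
      by (intro connected_continuous_image convex_connected convex_simplex_of)
        (meson continuous_on_subset order.trans)
    then show ?thesis using is_interval_connected_1 is_interval_convex by blast
  qed
  have yv: "y (vert S i j) \<in> y ` simplex_of S i" if "j \<in> J" for j
    using that vert_in_simplex_of unfolding J_def by blast
  have mean: "(\<Sum>j\<in>J. v j *\<^sub>R y (vert S i j)) \<in> y ` simplex_of S i" if "v \<in> weights (CARD('n)+1)" for v
    using weightsD[OF that] yv by (intro convex_sum conv) (auto simp: J_def)
  have "closed_segment Y (y (pt S i w)) \<subseteq> y ` simplex_of S i"
    using mean[OF iw(2)] pt_in_simplex[OF coll iw(2)]
    by (intro closed_segment_subset conv) (auto simp: Y_def)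
  then have "closed_segment Y (y (pt S i w)) \<subseteq> y ` X" using sX by blast
  then obtain d where d: "dh_low h \<le> d" "d \<le> dh_up h"
    and mvt: "hfun h (y (pt S i w)) - hfun h Y = (y (pt S i w) - Y) * d"
    using outer_mean_value[OF h X_subset] by blast
  have e: "- ml \<le> y (pt S i w) - Y" "y (pt S i w) - Y \<le> mu"
    using marginsD[OF coll y(2,1) iw] by (auto simp: Y_def J_def)
  have 1: "- max (- (mu * dh_low h)) (ml * dh_up h) \<le> hfun h (y (pt S i w)) - hfun h Y"
    "hfun h (y (pt S i w)) - hfun h Y \<le> max (- (ml * dh_low h)) (mu * dh_up h)"
    unfolding mvt using product_ge_max[OF e m d] product_le_max[OF e m d] by (simp_all add: max.commute)
  \<comment> \<open>The values that the interpolant of \<open>y\<close> takes on the simplex: here the bounds on \<open>h''\<close> are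
    known, and this is a convex set that contains the nodes \<open>y(x\<^sub>i\<^sub>j)\<close>.\<close>
  define Z where "Z = (\<lambda>v. \<Sum>j\<in>J. v j *\<^sub>R y (vert S i j)) ` weights (CARD('n)+1)"
  have Z: "convex Z" "Z \<subseteq> hdom h"
  proof -
    show "convex Z" unfolding Z_def J_def by (rule convex_weighted_sums)
    have "Z \<subseteq> y ` simplex_of S i" unfolding Z_def by (rule image_subsetI[OF mean])
    also have "\<dots> \<subseteq> y ` Xt" using sX X_subset by (intro image_mono) auto
    also have "\<dots> \<subseteq> hdom h" using h by (simp add: H_class_def)
    finally show "Z \<subseteq> hdom h" .
  qed
  have Zv: "y (vert S i j) \<in> Z" if "j \<in> J" for j
    using node_in_weighted_sums[of j "CARD('n)+1" "\<lambda>j. y (vert S i j)"] that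
    unfolding Z_def J_def by blast
  have ZI: "z \<in> interp S y ` X" if "z \<in> Z" for z
  proof -
    obtain v where "v \<in> weights (CARD('n)+1)" "z = interp S y (pt S i v)"
      using \<open>z \<in> Z\<close> interp_as_val[OF coll y(1) iw(1)] unfolding Z_def J_def by auto
    then show ?thesis using pt_in_X[OF coll iw(1)] by blast
  qed
  have H: "open (hdom h)" "C2_on (hdom h) (hfun h)"
    using h by (simp_all add: H_class_def)
  have "\<forall>t\<in>interp S y ` X. d2h_low h S \<le> deriv (deriv (hfun h)) t \<and> deriv (deriv (hfun h)) t \<le> d2h_up h S"
    using h coll by (simp only: H_class_def mem_Collect_eq) metis
  then have curv: "d2h_low h S \<le> deriv (deriv (hfun h)) z \<and> deriv (deriv (hfun h)) z \<le> d2h_up h S"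
    if "z \<in> Z" for z
    using ZI[OF that] by (rule bspec)
  have curv': "d2h_low h S \<le> deriv (deriv (\<lambda>u. hfun h (z + u *\<^sub>R \<nu>))) 0"
     "deriv (deriv (\<lambda>u. hfun h (z + u *\<^sub>R \<nu>))) 0 \<le> d2h_up h S" if "z \<in> Z" "norm \<nu> = 1" for z \<nu>
    using second_directional_derivative_real[OF H(2,1) subsetD[OF Z(2) that(1)] that(2)] curv[OF that(1)]
    by simp_all
  have Jn: "finite J" "card J = Suc CARD('n)" "1 \<le> CARD('n)" by (auto simp: J_def Suc_leI)
  have spread: "norm (y (vert S i j) - y (vert S i k)) \<le> tau S * g_const S y" if "j \<in> J" "k \<in> J" for j k
    using that vert_diff_le_grad[OF coll iw(1), of j k y] by (simp add: J_def)
  have c: "real CARD('n) * (tau S * g_const S y)\<^sup>2 / 8 = c"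
    by (simp add: c_def power_mult_distrib)
  have 2: "- (c * max 0 (d2h_up h S)) \<le> hfun h Y - (\<Sum>j\<in>J. w j * hfun h (y (vert S i j)))"
    "hfun h Y - (\<Sum>j\<in>J. w j * hfun h (y (vert S i j))) \<le> c * max 0 (- d2h_low h S)"
    using convex_combination_error[where p = "\<lambda>j. y (vert S i j)", OF Jn w spread Z Zv H curv', unfolded c]
    by (simp_all add: Y_def)
  have eqs: "\<Phi> (pt S i w) = hfun h (y (pt S i w))" "(\<Sum>j=1..CARD('n)+1. w j * \<Phi> (vert S i j))
      = (\<Sum>j\<in>J. w j * hfun h (y (vert S i j)))"
    using pt_in_X[OF coll iw] vert_in_X[OF coll iw(1)] X_subset \<Phi>(2)
    by (auto simp: J_def subset_iff intro!: sum.cong simp del: sum.cl_ivl_Suc)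
  show "- (max (- (mu * dh_low h)) (ml * dh_up h) + c * max 0 (d2h_up h S))
        \<le> \<Phi> (pt S i w) - (\<Sum>j=1..CARD('n)+1. w j * \<Phi> (vert S i j)) \<and>
      \<Phi> (pt S i w) - (\<Sum>j=1..CARD('n)+1. w j * \<Phi> (vert S i j))
        \<le> max (- (ml * dh_low h)) (mu * dh_up h) + c * max 0 (- d2h_low h S)"
    using 1 2 unfolding eqs by linarith
qed

lemma margins_curvature:
  assumes "C2_on Xt \<xi>"
    and "\<And>x \<nu>. x \<in> X \<Longrightarrow> norm \<nu> = 1 \<Longrightarrow> dl \<le> deriv (deriv (\<lambda>u. \<xi> (x + u *\<^sub>R \<nu>))) 0"
    and "\<And>x \<nu>. x \<in> X \<Longrightarrow> norm \<nu> = 1 \<Longrightarrow> deriv (deriv (\<lambda>u. \<xi> (x + u *\<^sub>R \<nu>))) 0 \<le> du"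
    and "continuous_on Xt \<xi>"
  shows "margins X S \<xi> (real CARD('n) * (tau S)\<^sup>2 / 8 * max 0 du) (real CARD('n) * (tau S)\<^sup>2 / 8 * max 0 (- dl))"
proof (rule marginsI[OF coll assms(4)])
  fix i w assume iw: "i \<in> idx S" "w \<in> weights (CARD('n)+1)"
  have s: "simplex_of S i \<subseteq> X" "simplex_of S i \<subseteq> Xt"
    using simplex_subset[OF coll iw(1)] X_subset by auto
  have J: "finite {1..CARD('n)+1}" "card {1..CARD('n)+1} = Suc CARD('n)" "1 \<le> CARD('n)"
    by (auto simp: Suc_leI)
  have "- (real CARD('n) * (tau S)\<^sup>2 / 8 * max 0 du)
        \<le> \<xi> (\<Sum>j=1..CARD('n)+1. w j *\<^sub>R vert S i j) - (\<Sum>j=1..CARD('n)+1. w j * \<xi> (vert S i j))"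
    "\<xi> (\<Sum>j=1..CARD('n)+1. w j *\<^sub>R vert S i j) - (\<Sum>j=1..CARD('n)+1. w j * \<xi> (vert S i j))
        \<le> real CARD('n) * (tau S)\<^sup>2 / 8 * max 0 (- dl)"
    by (rule convex_combination_error[where p = "vert S i", OF J weightsD[OF iw(2)] vert_dist_le_tau[OF coll iw(1)]
      convex_simplex_of s(2) vert_in_simplex_of open_Xt assms(1) assms(2,3)[OF subsetD[OF s(1)]]]; assumption)+
  then show "- (real CARD('n) * (tau S)\<^sup>2 / 8 * max 0 du)
        \<le> \<xi> (pt S i w) - (\<Sum>j=1..CARD('n)+1. w j * \<xi> (vert S i j)) \<and>
      \<xi> (pt S i w) - (\<Sum>j=1..CARD('n)+1. w j * \<xi> (vert S i j))
        \<le> real CARD('n) * (tau S)\<^sup>2 / 8 * max 0 (- dl)"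
    unfolding pt_def by blast
qed simp_all

end

end

section \<open>Second order of the margins\<close>

text \<open>
  A Lipschitz condition between points whose connecting segment stays inside the set. A smooth
  function satisfies it on a compact set of any shape, whereas the ordinary Lipschitz condition would
  also compare values across gaps; edges of a simplex are segments inside \<open>X\<close>, so it
  suffices to bound \<open>g\<close>.
\<close>

definition segment_lipschitz :: "'a::real_normed_vector set \<Rightarrow> ('a \<Rightarrow> real) \<Rightarrow> bool" where
  "segment_lipschitz A f \<longleftrightarrow>
     (\<exists>L\<ge>0. \<forall>a b. closed_segment a b \<subseteq> A \<longrightarrow> \<bar>f a - f b\<bar> \<le> L * norm (a - b))"

lemma segment_lipschitzE:
  assumes "segment_lipschitz A f"
  obtains L where "0 \<le> L" "\<And>a b. closed_segment a b \<subseteq> A \<Longrightarrow> \<bar>f a - f b\<bar> \<le> L * norm (a - b)"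
  using assms unfolding segment_lipschitz_def by blast

lemma segment_lipschitz_sum:
  assumes "finite I" "\<And>s. s \<in> I \<Longrightarrow> segment_lipschitz A (f s)"
  shows "segment_lipschitz A (\<lambda>x. \<Sum>s\<in>I. f s x)"
proof -
  have "\<exists>L. 0 \<le> L \<and> (\<forall>a b. closed_segment a b \<subseteq> A \<longrightarrow> \<bar>f s a - f s b\<bar> \<le> L * norm (a - b))"
    if "s \<in> I" for s
    using assms(2)[OF that] unfolding segment_lipschitz_def by blast
  then obtain L where L: "\<And>s. s \<in> I \<Longrightarrow> 0 \<le> L s"
    "\<And>s a b. s \<in> I \<Longrightarrow> closed_segment a b \<subseteq> A \<Longrightarrow> \<bar>f s a - f s b\<bar> \<le> L s * norm (a - b)"
    by metis
  show ?thesis unfolding segment_lipschitz_def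
  proof (intro exI[of _ "\<Sum>s\<in>I. L s"] conjI allI impI sum_nonneg L)
    fix a b assume "closed_segment a b \<subseteq> A"
    then show "\<bar>(\<Sum>s\<in>I. f s a) - (\<Sum>s\<in>I. f s b)\<bar> \<le> (\<Sum>s\<in>I. L s) * norm (a - b)"
      unfolding sum_subtractf[symmetric] sum_distrib_right
      by (intro order.trans[OF sum_abs] sum_mono L)
  qed
qed

lemma segment_lipschitz_mult:
  assumes f: "segment_lipschitz A f" "\<And>x. x \<in> A \<Longrightarrow> \<bar>f x\<bar> \<le> F"
    and g: "segment_lipschitz A g" "\<And>x. x \<in> A \<Longrightarrow> \<bar>g x\<bar> \<le> G"
    and "0 \<le> F" "0 \<le> G"
  shows "segment_lipschitz A (\<lambda>x. f x * g x)"
proof -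
  obtain L where L: "0 \<le> L" "\<And>a b. closed_segment a b \<subseteq> A \<Longrightarrow> \<bar>f a - f b\<bar> \<le> L * norm (a - b)"
    using f(1) by (rule segment_lipschitzE) (rule that)
  obtain M where M: "0 \<le> M" "\<And>a b. closed_segment a b \<subseteq> A \<Longrightarrow> \<bar>g a - g b\<bar> \<le> M * norm (a - b)"
    using g(1) by (rule segment_lipschitzE) (rule that)
  show ?thesis unfolding segment_lipschitz_def
  proof (intro exI[of _ "L * G + F * M"] conjI allI impI)
    show "0 \<le> L * G + F * M" using assms L(1) M(1) by simp
    fix a b assume seg: "closed_segment a b \<subseteq> A"
    then have ab: "a \<in> A" "b \<in> A" by auto
    have "f a * g a - f b * g b = (f a - f b) * g a + f b * (g a - g b)"
      by (simp add: algebra_simps)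
    also have "\<bar>\<dots>\<bar> \<le> \<bar>f a - f b\<bar> * \<bar>g a\<bar> + \<bar>f b\<bar> * \<bar>g a - g b\<bar>"
      by (rule order.trans[OF abs_triangle_ineq]) (simp add: abs_mult)
    also have "\<dots> \<le> (L * norm (a - b)) * G + F * (M * norm (a - b))"
      using L M f g ab seg assms(5,6) by (intro add_mono mult_mono) auto
    finally show "\<bar>f a * g a - f b * g b\<bar> \<le> (L * G + F * M) * norm (a - b)"
      by (simp add: algebra_simps)
  qed
qed

lemma segment_bound_from_derivative:
  fixes f :: "'a::real_normed_vector \<Rightarrow> real"
  assumes "\<And>x. x \<in> closed_segment a b \<Longrightarrow> (f has_derivative blinfun_apply (f' x)) (at x)"
    and "\<And>x. x \<in> closed_segment a b \<Longrightarrow> norm (f' x) \<le> L"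
  shows "\<bar>f a - f b\<bar> \<le> L * norm (a - b)"
proof -
  have 1: "(f has_derivative blinfun_apply (f' x)) (at x within closed_segment a b)"
    if "x \<in> closed_segment a b" for x
    by (rule has_derivative_at_withinI[OF assms(1)[OF that]])
  have 2: "onorm (blinfun_apply (f' x)) \<le> L" if "x \<in> closed_segment a b" for x
    using assms(2)[OF that] by (simp add: norm_blinfun.rep_eq)
  have "norm (f a - f b) \<le> L * norm (a - b)"
    using differentiable_bound[OF convex_closed_segment 1 2 ends_in_segment]
    by blast
  then show ?thesis by simp
qed

context sampled_domain
begin

text \<open>
  The analytic properties of a function that survive products, sums and outer functions and that
  keep the coefficients in the margins bounded.
\<close>

definition regular :: "(real^'n \<Rightarrow> real) \<Rightarrow> bool" where
  "regular f \<longleftrightarrow> continuous_on Xt f \<and> segment_lipschitz X f"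

lemma bounded_on_X:
  fixes f :: "real^'n \<Rightarrow> real"
  assumes "continuous_on Xt f"
  obtains B where "0 \<le> B" "\<And>x. x \<in> X \<Longrightarrow> \<bar>f x\<bar> \<le> B"
proof -
  have "continuous_on X f" using assms X_subset by (rule continuous_on_subset)
  then have "bounded (f ` X)" using compact_X by (intro compact_imp_bounded compact_continuous_image)
  then obtain B where "\<And>x. x \<in> X \<Longrightarrow> \<bar>f x\<bar> \<le> B" "0 < B"
    unfolding bounded_pos by auto
  then show ?thesis by (intro that[of B]) auto
qed

lemma regular_C2:
  assumes "C2_on Xt f"
  shows "regular f"
proof -
  obtain f' :: "real^'n \<Rightarrow> (real^'n) \<Rightarrow>\<^sub>L real" and f'' :: "real^'n \<Rightarrow> (real^'n) \<Rightarrow>\<^sub>L (real^'n) \<Rightarrow>\<^sub>L real"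
    where f': "\<And>x. x \<in> Xt \<Longrightarrow> (f has_derivative blinfun_apply (f' x)) (at x)"
    and f'': "\<And>x. x \<in> Xt \<Longrightarrow> (f' has_derivative blinfun_apply (f'' x)) (at x)"
    using assms unfolding C2_on_def by blast
  have "continuous_on Xt f"
    using f' by (intro continuous_at_imp_continuous_on ballI has_derivative_continuous)
  moreover have "segment_lipschitz X f"
  proof -
    have "continuous_on Xt (\<lambda>x. norm (f' x))"
      using f'' by (intro continuous_on_norm continuous_at_imp_continuous_on ballI has_derivative_continuous)
    then obtain L where L: "0 \<le> L" "\<And>x. x \<in> X \<Longrightarrow> \<bar>norm (f' x)\<bar> \<le> L"
      by (rule bounded_on_X) (rule that)
    have "\<bar>f a - f b\<bar> \<le> L * norm (a - b)" if seg: "closed_segment a b \<subseteq> X" for a b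
    proof (rule segment_bound_from_derivative)
      fix x assume "x \<in> closed_segment a b"
      then have x: "x \<in> X" using seg by (rule subsetD[rotated])
      show "(f has_derivative blinfun_apply (f' x)) (at x)" using x X_subset by (intro f') blast
      show "norm (f' x) \<le> L" using L(2)[OF x] by simp
    qed
    with L(1) show ?thesis
      unfolding segment_lipschitz_def by (intro exI[of _ L] conjI allI impI)
  qed
  ultimately show ?thesis by (simp add: regular_def)
qed

lemma regular_mult:
  assumes "regular f" "regular g"
  shows "regular (\<lambda>x. f x * g x)"
proof -
  have c: "continuous_on Xt f" "continuous_on Xt g" using assms by (auto simp: regular_def)
  obtain F where F: "0 \<le> F" "\<And>x. x \<in> X \<Longrightarrow> \<bar>f x\<bar> \<le> F" using c(1) by (rule bounded_on_X) (rule that)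
  obtain G where G: "0 \<le> G" "\<And>x. x \<in> X \<Longrightarrow> \<bar>g x\<bar> \<le> G" using c(2) by (rule bounded_on_X) (rule that)
  show ?thesis
    using assms F G unfolding regular_def
    by (auto intro!: continuous_intros intro: segment_lipschitz_mult[of X f F g G])
qed

lemma regular_inner_fun:
  assumes "\<And>s. s \<in> {1..T} \<Longrightarrow> regular (phi D s)" "\<And>s. s \<in> {1..T} \<Longrightarrow> regular (psi D s)"
  shows "regular (inner_fun T D)"
proof -
  have "regular (\<lambda>x. phi D s x * psi D s x)" if "s \<in> {1..T}" for s
    using that by (intro regular_mult assms)
  then show ?thesis
    unfolding regular_def inner_fun_def[abs_def]
    by (intro conjI continuous_on_sum segment_lipschitz_sum) auto
qed

text \<open>
  The known slope bounds of \<open>h\<close> give the Lipschitz constant: the image of a segment in \<open>X\<close> under \<open>y\<close>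
  is connected, hence contains all values between its end points.
\<close>

lemma regular_outer:
  assumes y: "regular y" and h: "h \<in> H_class X Xt y" and \<Phi>: "\<And>x. x \<in> Xt \<Longrightarrow> \<Phi> x = hfun h (y x)"
  shows "regular \<Phi>"
proof -
  have cy: "continuous_on Xt y" and "segment_lipschitz X y" using y by (auto simp: regular_def)
  then obtain L where L: "0 \<le> L" "\<And>a b. closed_segment a b \<subseteq> X \<Longrightarrow> \<bar>y a - y b\<bar> \<le> L * norm (a - b)"
    by (auto elim: segment_lipschitzE)
  have H: "C2_on (hdom h) (hfun h)" "y ` Xt \<subseteq> hdom h" using h by (simp_all add: H_class_def)
  have "continuous_on (hdom h) (hfun h)"
    using C2_on_has_real_derivative[OF H(1)]
    by (intro continuous_at_imp_continuous_on ballI DERIV_isCont)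
  then have "continuous_on Xt (\<lambda>x. hfun h (y x))"
    using cy H(2) by (intro continuous_on_compose2[of "hdom h" "hfun h" Xt y])
  then have "continuous_on Xt \<Phi>" using \<Phi> by (simp cong: continuous_on_cong)
  moreover have "segment_lipschitz X \<Phi>"
    unfolding segment_lipschitz_def
  proof (intro exI[of _ "max \<bar>dh_low h\<bar> \<bar>dh_up h\<bar> * L"] conjI allI impI)
    let ?M = "max \<bar>dh_low h\<bar> \<bar>dh_up h\<bar>"
    show "0 \<le> ?M * L" using L(1) by simp
    fix a b assume seg: "closed_segment a b \<subseteq> X"
    have ab: "a \<in> X" "b \<in> X" using seg by auto
    have "connected (y ` closed_segment a b)"
      using cy seg X_subset
      by (intro connected_continuous_image connected_segment) (meson continuous_on_subset order.trans)
    then have "convex (y ` closed_segment a b)"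
      using is_interval_connected_1 is_interval_convex by blast
    then have "closed_segment (y b) (y a) \<subseteq> y ` closed_segment a b"
      by (intro closed_segment_subset) auto
    also have "\<dots> \<subseteq> y ` X" using seg by (rule image_mono)
    finally obtain d where d: "dh_low h \<le> d" "d \<le> dh_up h" "hfun h (y a) - hfun h (y b) = (y a - y b) * d"
      using outer_mean_value[OF h X_subset] by blast
    have "\<bar>\<Phi> a - \<Phi> b\<bar> = \<bar>d\<bar> * \<bar>y a - y b\<bar>"
      using d(3) \<Phi> ab X_subset by (simp add: subset_iff abs_mult)
    also have "\<dots> \<le> ?M * (L * norm (a - b))"
      using d(1,2) L(2)[OF seg] by (intro mult_mono) auto
    finally show "\<bar>\<Phi> a - \<Phi> b\<bar> \<le> ?M * L * norm (a - b)" by (simp add: mult_ac)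
  qed
  ultimately show ?thesis by (simp add: regular_def)
qed

text \<open>
  Both notions refer to all simplex collections and not only to those with small \<open>\<tau>\<close>, which is more
  than the order relation asks for. As \<open>\<tau>\<close> never exceeds the diameter of \<open>X\<close>, a second-order quantity
  is then itself bounded, and no threshold for \<open>\<tau>\<close> has to be carried through the recursion.
\<close>

definition uniformly_bounded :: "((real^'n) simplex_coll \<Rightarrow> real) \<Rightarrow> bool" where
  "uniformly_bounded m \<longleftrightarrow> (\<exists>B\<ge>0. \<forall>S. simplex_collection X Xt S \<longrightarrow> \<bar>m S\<bar> \<le> B)"

definition second_order :: "((real^'n) simplex_coll \<Rightarrow> real) \<Rightarrow> bool" where
  "second_order m \<longleftrightarrow> uniformly_bounded (\<lambda>S. m S / (tau S)\<^sup>2)"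

lemma uniformly_boundedI:
  assumes "\<And>S. simplex_collection X Xt S \<Longrightarrow> \<bar>m S\<bar> \<le> B"
  shows "uniformly_bounded m"
  unfolding uniformly_bounded_def using assms
  by (intro exI[of _ "max 0 B"]) (auto simp: le_max_iff_disj)

lemma uniformly_boundedE:
  assumes "uniformly_bounded m"
  obtains B where "0 \<le> B" "\<And>S. simplex_collection X Xt S \<Longrightarrow> \<bar>m S\<bar> \<le> B"
  using assms unfolding uniformly_bounded_def by blast

lemma uniformly_bounded_cong:
  assumes "\<And>S. simplex_collection X Xt S \<Longrightarrow> m S = m' S"
  shows "uniformly_bounded m \<longleftrightarrow> uniformly_bounded m'"
  unfolding uniformly_bounded_def using assms by simp

lemma uniformly_bounded_const: "uniformly_bounded (\<lambda>S. c)"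
  by (rule uniformly_boundedI[of _ "\<bar>c\<bar>"]) simp

lemma uniformly_bounded_minus: "uniformly_bounded m \<Longrightarrow> uniformly_bounded (\<lambda>S. - m S)"
  unfolding uniformly_bounded_def by simp

lemma uniformly_bounded_add:
  assumes "uniformly_bounded m" "uniformly_bounded m'"
  shows "uniformly_bounded (\<lambda>S. m S + m' S)"
proof -
  obtain B B' where "\<And>S. simplex_collection X Xt S \<Longrightarrow> \<bar>m S\<bar> \<le> B"
    "\<And>S. simplex_collection X Xt S \<Longrightarrow> \<bar>m' S\<bar> \<le> B'"
    using assms by (metis uniformly_boundedE)
  then show ?thesis
    by (intro uniformly_boundedI[of _ "B + B'"] order.trans[OF abs_triangle_ineq] add_mono)
qed

lemma uniformly_bounded_mult:
  assumes "uniformly_bounded m" "uniformly_bounded m'"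
  shows "uniformly_bounded (\<lambda>S. m S * m' S)"
proof -
  obtain B B' where "0 \<le> B" "\<And>S. simplex_collection X Xt S \<Longrightarrow> \<bar>m S\<bar> \<le> B"
    "\<And>S. simplex_collection X Xt S \<Longrightarrow> \<bar>m' S\<bar> \<le> B'"
    using assms by (metis uniformly_boundedE)
  then show ?thesis
    by (intro uniformly_boundedI[of _ "B * B'"]) (auto simp: abs_mult intro!: mult_mono)
qed

lemma uniformly_bounded_max:
  assumes "uniformly_bounded m" "uniformly_bounded m'"
  shows "uniformly_bounded (\<lambda>S. max (m S) (m' S))"
proof -
  obtain B B' where B: "\<And>S. simplex_collection X Xt S \<Longrightarrow> \<bar>m S\<bar> \<le> B"
    "\<And>S. simplex_collection X Xt S \<Longrightarrow> \<bar>m' S\<bar> \<le> B'"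
    using assms by (metis uniformly_boundedE)
  show ?thesis
  proof (rule uniformly_boundedI[of _ "max B B'"])
    fix S assume "simplex_collection X Xt S"
    from B[OF this] show "\<bar>max (m S) (m' S)\<bar> \<le> max B B'" by linarith
  qed
qed

lemma second_order_tau_squared: "second_order (\<lambda>S. (tau S)\<^sup>2)"
  unfolding second_order_def
  by (rule uniformly_boundedI[of _ 1]) (auto dest: tau_pos)

lemma second_order_add: "second_order m \<Longrightarrow> second_order m' \<Longrightarrow> second_order (\<lambda>S. m S + m' S)"
  unfolding second_order_def add_divide_distrib by (rule uniformly_bounded_add)

lemma second_order_sum:
  assumes "finite A" "\<And>s. s \<in> A \<Longrightarrow> second_order (m s)"
  shows "second_order (\<lambda>S. \<Sum>s\<in>A. m s S)"
  using assms
proof (induction A rule: finite_induct)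
  case empty
  then show ?case using uniformly_bounded_const[of 0] by (simp add: second_order_def)
next
  case (insert s A)
  then show ?case by (simp add: second_order_add)
qed

lemma second_order_minus: "second_order m \<Longrightarrow> second_order (\<lambda>S. - m S)"
  unfolding second_order_def by (drule uniformly_bounded_minus) simp

lemma second_order_mult:
  assumes "second_order m" "uniformly_bounded c"
  shows "second_order (\<lambda>S. m S * c S)"
  using uniformly_bounded_mult[OF assms[unfolded second_order_def]]
  by (simp add: second_order_def)

lemma second_order_max:
  assumes "second_order m" "second_order m'"
  shows "second_order (\<lambda>S. max (m S) (m' S))"
proof -
  have "max (m S) (m' S) / (tau S)\<^sup>2 = max (m S / (tau S)\<^sup>2) (m' S / (tau S)\<^sup>2)" for S
    by (rule max_divide_distrib_right[THEN trans]) simp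
  then show ?thesis using uniformly_bounded_max[OF assms[unfolded second_order_def]]
    by (simp add: second_order_def)
qed

lemma uniformly_bounded_second_order:
  assumes "second_order m"
  shows "uniformly_bounded m"
proof -
  have "uniformly_bounded (\<lambda>S. (tau S)\<^sup>2)"
    by (rule uniformly_boundedI[of _ "(diameter X)\<^sup>2"])
      (auto intro!: power_mono tau_le_diameter less_imp_le[OF tau_pos])
  then have "uniformly_bounded (\<lambda>S. m S / (tau S)\<^sup>2 * (tau S)\<^sup>2)"
    using assms unfolding second_order_def by (intro uniformly_bounded_mult)
  then show ?thesis
    by (subst uniformly_bounded_cong[of m "\<lambda>S. m S / (tau S)\<^sup>2 * (tau S)\<^sup>2"]) (auto dest: tau_pos)
qed

lemma bigO'_second_order:
  assumes "second_order m"
  shows "bigO' X Xt 2 m"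
proof -
  obtain C where C: "0 \<le> C" "\<And>S. simplex_collection X Xt S \<Longrightarrow> \<bar>m S / (tau S)\<^sup>2\<bar> \<le> C"
    using assms unfolding second_order_def by (rule uniformly_boundedE) blast
  have "\<bar>m S\<bar> \<le> (C + 1) * (tau S)\<^sup>2" if S: "simplex_collection X Xt S" for S
  proof -
    \<comment> \<open>The order relation asks for a positive constant, and \<open>C\<close> may be \<open>0\<close>.\<close>
    have "\<bar>m S\<bar> \<le> C * (tau S)\<^sup>2"
      using C(2)[OF S] tau_pos[OF S] by (simp add: abs_divide divide_le_eq)
    also have "\<dots> \<le> (C + 1) * (tau S)\<^sup>2" by (intro mult_right_mono) auto
    finally show ?thesis .
  qed
  then show ?thesis unfolding bigO'_def using C(1)
    by (intro exI[of _ 1] conjI exI[of _ "C + 1"]) auto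
qed

text \<open>
  The division by \<open>\<tau>\<close> in \<open>g\<close> is harmless: the ends of an edge are at most \<open>\<tau>\<close> apart, so a Lipschitz
  constant along edges bounds all difference quotients.
\<close>

lemma uniformly_bounded_grad:
  assumes "regular f"
  shows "uniformly_bounded (\<lambda>S. g_const S f)"
proof -
  obtain L where L: "0 \<le> L" "\<And>a b. closed_segment a b \<subseteq> X \<Longrightarrow> \<bar>f a - f b\<bar> \<le> L * norm (a - b)"
    using assms unfolding regular_def by (auto elim: segment_lipschitzE)
  show ?thesis
  proof (rule uniformly_boundedI[of _ L])
    fix S assume S: "simplex_collection X Xt S"
    have "\<bar>f (vert S i j) - f (vert S i k)\<bar> / tau S \<le> L"
      if "i \<in> idx S" "j \<in> {1..CARD('n)+1}" "k \<in> {1..CARD('n)+1}" for i j k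
    proof -
      have "closed_segment (vert S i j) (vert S i k) \<subseteq> X"
        using simplex_subset[OF S that(1)] that(2,3)
        by (meson closed_segment_subset convex_simplex_of order.trans vert_in_simplex_of)
      then have "\<bar>f (vert S i j) - f (vert S i k)\<bar> \<le> L * norm (vert S i j - vert S i k)"
        by (rule L(2))
      also have "\<dots> \<le> L * tau S"
        by (intro mult_left_mono vert_dist_le_tau[OF S that] L(1))
      finally show ?thesis using tau_pos[OF S] by (simp add: divide_le_eq)
    qed
    then have "g_const S f \<le> L"
      unfolding g_const_def
      by (subst Max_triple_le_iff) (use finite_idx[OF S] idx_nonempty[OF S] in auto)
    then show "\<bar>g_const S f\<bar> \<le> L" using grad_nonneg[OF S, of f] by simp
  qed
qed

lemma uniformly_bounded_bnds:
  assumes "continuous_on Xt f" "uniformly_bounded m"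
  shows "uniformly_bounded (\<lambda>S. b_low S f (m S))" "uniformly_bounded (\<lambda>S. b_up S f (m S))"
proof -
  obtain B where B: "0 \<le> B" "\<And>x. x \<in> X \<Longrightarrow> \<bar>f x\<bar> \<le> B" using assms(1) by (rule bounded_on_X) (rule that)
  let ?V = "\<lambda>S. {f (vert S i j) | i j. i \<in> idx S \<and> j \<in> {1..CARD('n)+1}}"
  have V: "finite (?V S)" "?V S \<noteq> {}" "\<And>v. v \<in> ?V S \<Longrightarrow> \<bar>v\<bar> \<le> B" if "simplex_collection X Xt S" for S
  proof -
    show "finite (?V S)" by (intro finite_pair_image finite_idx[OF that] finite_atLeastAtMost)
    show "?V S \<noteq> {}" using idx_nonempty[OF that] by fastforce
    show "\<bar>v\<bar> \<le> B" if "v \<in> ?V S" for v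
      using that vert_in_X[OF \<open>simplex_collection X Xt S\<close>] B(2) by blast
  qed
  have "uniformly_bounded (\<lambda>S. Min (?V S))" "uniformly_bounded (\<lambda>S. Max (?V S))"
  proof -
    have "\<bar>Min (?V S)\<bar> \<le> B" if "simplex_collection X Xt S" for S
      by (rule V(3)[OF that Min_in[OF V(1)[OF that] V(2)[OF that]]])
    then show "uniformly_bounded (\<lambda>S. Min (?V S))" by (rule uniformly_boundedI)
    have "\<bar>Max (?V S)\<bar> \<le> B" if "simplex_collection X Xt S" for S
      by (rule V(3)[OF that Max_in[OF V(1)[OF that] V(2)[OF that]]])
    then show "uniformly_bounded (\<lambda>S. Max (?V S))" by (rule uniformly_boundedI)
  qed
  then show "uniformly_bounded (\<lambda>S. b_low S f (m S))" "uniformly_bounded (\<lambda>S. b_up S f (m S))"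
    unfolding b_low_def b_up_def
    using uniformly_bounded_add[OF _ uniformly_bounded_minus[OF assms(2)]] uniformly_bounded_add[OF _ assms(2)]
    by simp_all
qed

text \<open>
  What the procedure has to deliver for a function, for all simplex collections at once.
\<close>

definition certified :: "(real^'n \<Rightarrow> real) \<Rightarrow> ((real^'n) simplex_coll \<Rightarrow> result) \<Rightarrow> bool" where
  "certified \<xi> R \<longleftrightarrow> (\<forall>S. simplex_collection X Xt S \<longrightarrow> valid_result S \<xi> (R S)) \<and>
     second_order (\<lambda>S. m_low (R S)) \<and> second_order (\<lambda>S. m_up (R S))"

lemma certified_bounded_fields:
  assumes "regular \<xi>" "certified \<xi> R"
  shows "uniformly_bounded (\<lambda>S. bnd_low (R S))" "uniformly_bounded (\<lambda>S. bnd_up (R S))"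
    "uniformly_bounded (\<lambda>S. grad (R S))"
proof -
  have m: "uniformly_bounded (\<lambda>S. m_low (R S))" "uniformly_bounded (\<lambda>S. m_up (R S))"
    using assms(2) by (auto simp: certified_def intro: uniformly_bounded_second_order)
  have c: "continuous_on Xt \<xi>" using assms(1) by (simp add: regular_def)
  have v: "valid_result S \<xi> (R S)" if "simplex_collection X Xt S" for S
    using assms(2) that by (simp add: certified_def)
  show "uniformly_bounded (\<lambda>S. bnd_low (R S))"
    using uniformly_bounded_bnds(1)[OF c m(1)]
    by (subst uniformly_bounded_cong) (auto dest!: v valid_result_fields(3))
  show "uniformly_bounded (\<lambda>S. bnd_up (R S))"
    using uniformly_bounded_bnds(2)[OF c m(2)]
    by (subst uniformly_bounded_cong) (auto dest!: v valid_result_fields(4))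
  show "uniformly_bounded (\<lambda>S. grad (R S))"
    using uniformly_bounded_grad[OF assms(1)]
    by (subst uniformly_bounded_cong) (auto dest!: v valid_result_fields(5))
qed

lemma second_order_product_margins:
  assumes p: "regular \<phi>" "certified \<phi> P" and q: "regular \<psi>" "certified \<psi> Q"
  shows "second_order (\<lambda>S. a_low (P S) (Q S) + a_low (Q S) (P S) + (tau S)\<^sup>2 * grad (P S) * grad (Q S))"
    and "second_order (\<lambda>S. a_up (P S) (Q S) + a_up (Q S) (P S) + (tau S)\<^sup>2 * grad (P S) * grad (Q S))"
  using assms certified_bounded_fields[OF p] certified_bounded_fields[OF q]
  unfolding a_low_def a_up_def certified_def
  by (auto intro!: second_order_add second_order_max second_order_minus second_order_mult
      second_order_tau_squared)

end

section \<open>The recursion\<close>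

context sampled_domain
begin

lemma certified_step0:
  assumes "\<xi> \<in> F1_class X Xt K"
  shows "certified \<xi> (\<lambda>S. step0 K S \<xi>)"
proof -
  obtain dl du where C2: "C2_on Xt \<xi>" and K: "curv K \<xi> = Some (dl, du)"
    and curv: "\<And>x \<nu>. x \<in> X \<Longrightarrow> norm \<nu> = 1 \<Longrightarrow> dl \<le> deriv (deriv (\<lambda>u. \<xi> (x + u *\<^sub>R \<nu>))) 0"
      "\<And>x \<nu>. x \<in> X \<Longrightarrow> norm \<nu> = 1 \<Longrightarrow> deriv (deriv (\<lambda>u. \<xi> (x + u *\<^sub>R \<nu>))) 0 \<le> du"
    using assms unfolding F1_class_def by blast
  have step: "step0 K S \<xi> = mk_result S \<xi> (real CARD('n) * (tau S)\<^sup>2 / 8 * max 0 du)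
      (real CARD('n) * (tau S)\<^sup>2 / 8 * max 0 (- dl))" for S
    by (simp add: step0_def K)
  have "continuous_on Xt \<xi>" using regular_C2[OF C2] by (simp add: regular_def)
  then have "valid_result S \<xi> (step0 K S \<xi>)" if "simplex_collection X Xt S" for S
    using margins_curvature[OF that C2 curv] by (simp add: valid_result_def step mk_result_def)
  moreover have "second_order (\<lambda>S. real CARD('n) * (tau S)\<^sup>2 / 8 * c)" for c
    using second_order_mult[OF second_order_tau_squared uniformly_bounded_const[of "real CARD('n) / 8 * c"]]
    by (simp add: mult_ac)
  ultimately show ?thesis by (simp add: certified_def step mk_result_def)
qed

lemma certified_compose_step:
  assumes \<phi>: "\<And>s. s \<in> {1..T} \<Longrightarrow> regular (phi D s)"
      "\<And>s. s \<in> {1..T} \<Longrightarrow> certified (phi D s) (\<lambda>S. R S (phi D s))"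
    and \<psi>: "\<And>s. s \<in> {1..T} \<Longrightarrow> regular (psi D s)"
      "\<And>s. s \<in> {1..T} \<Longrightarrow> certified (psi D s) (\<lambda>S. R S (psi D s))"
    and h: "out D \<in> H_class X Xt (inner_fun T D)"
    and \<Phi>: "\<And>x. x \<in> Xt \<Longrightarrow> \<Phi> x = hfun (out D) (inner_fun T D x)"
  shows "certified \<Phi> (\<lambda>S. compose_step T S D (R S) \<Phi>)"
proof -
  let ?y = "inner_fun T D" and ?h = "out D"
  define l where "l s S = a_low (R S (phi D s)) (R S (psi D s)) + a_low (R S (psi D s)) (R S (phi D s))
      + (tau S)\<^sup>2 * grad (R S (phi D s)) * grad (R S (psi D s))" for s S
  define u where "u s S = a_up (R S (phi D s)) (R S (psi D s)) + a_up (R S (psi D s)) (R S (phi D s))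
      + (tau S)\<^sup>2 * grad (R S (phi D s)) * grad (R S (psi D s))" for s S
  define L where "L S = (\<Sum>s=1..T. l s S)" for S
  define U where "U S = (\<Sum>s=1..T. u s S)" for S
  define c where "c S = (tau S)\<^sup>2 * (real CARD('n) * (g_const S ?y)\<^sup>2 / 8)" for S
  have step: "compose_step T S D (R S) \<Phi> = mk_result S \<Phi>
      (max (- (U S * dh_low ?h)) (L S * dh_up ?h) + c S * max 0 (d2h_up ?h S))
      (max (- (L S * dh_low ?h)) (U S * dh_up ?h) + c S * max 0 (- d2h_low ?h S))" for S
    unfolding compose_step_def Let_def L_def U_def l_def u_def c_def ..
  have y: "regular ?y" using \<phi>(1) \<psi>(1) by (rule regular_inner_fun)
  then have cont: "continuous_on Xt ?y" "continuous_on Xt \<Phi>"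
    using regular_outer[OF y h \<Phi>] by (simp_all add: regular_def)
  have "valid_result S \<Phi> (compose_step T S D (R S) \<Phi>)" if S: "simplex_collection X Xt S" for S
  proof -
    have "margins X S (\<lambda>x. phi D s x * psi D s x) (l s S) (u s S)" if "s \<in> {1..T}" for s
      unfolding l_def u_def using \<phi>[OF that] \<psi>[OF that] S
      by (intro margins_product) (auto simp: certified_def regular_def)
    then have "margins X S ?y (L S) (U S)"
      unfolding L_def U_def inner_fun_def[abs_def] using \<phi>(1) \<psi>(1)
      by (intro margins_sum[OF S]) (auto simp: regular_def intro!: continuous_intros)
    from margins_outer[OF S cont(1) this h cont(2) \<Phi>] show ?thesis
      by (simp add: valid_result_def step mk_result_def c_def)
  qed
  moreover have "second_order (\<lambda>S. m_low (compose_step T S D (R S) \<Phi>))"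
    "second_order (\<lambda>S. m_up (compose_step T S D (R S) \<Phi>))"
  proof -
    note product = second_order_product_margins[OF \<phi>(1) \<phi>(2) \<psi>(1) \<psi>(2)]
    have LU: "second_order L" "second_order U"
      unfolding L_def[abs_def] U_def[abs_def] l_def u_def
      by (rule second_order_sum[OF finite_atLeastAtMost], rule product; assumption)+
    obtain C where C: "\<And>S. simplex_collection X Xt S \<Longrightarrow> \<bar>d2h_low ?h S\<bar> + \<bar>d2h_up ?h S\<bar> < C"
      using h unfolding H_class_def mem_Collect_eq by metis
    have d2: "uniformly_bounded (\<lambda>S. max 0 (d2h_up ?h S))" "uniformly_bounded (\<lambda>S. max 0 (- d2h_low ?h S))"
      by (rule uniformly_boundedI[of _ C], drule C, linarith)+
    have g2: "uniformly_bounded (\<lambda>S. g_const S ?y * g_const S ?y)"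
      using uniformly_bounded_grad[OF y] by (intro uniformly_bounded_mult)
    have "second_order c"
      using second_order_mult[OF second_order_tau_squared
          uniformly_bounded_mult[OF uniformly_bounded_const[of "real CARD('n) / 8"] g2]]
      by (simp add: c_def[abs_def] power2_eq_square mult_ac)
    with LU d2 show "second_order (\<lambda>S. m_low (compose_step T S D (R S) \<Phi>))"
      "second_order (\<lambda>S. m_up (compose_step T S D (R S) \<Phi>))"
      unfolding step mk_result_def
      by (auto intro!: second_order_add second_order_max second_order_minus second_order_mult
          uniformly_bounded_const)
  qed
  ultimately show ?thesis by (simp add: certified_def)
qed

text \<open>
  Regularity is part of the induction because the step for \<open>N\<close> needs bounded values and difference
  quotients of the \<open>\<phi>\<^sub>s\<close> and \<open>\<psi>\<^sub>s\<close>. A factor with known curvature bounds is handled by the initial step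
  whatever its level; either way its result is certified, so the step need not distinguish.
\<close>

lemma certified_procA:
  assumes "\<Phi> \<in> F_class X Xt T K N"
  shows "regular \<Phi> \<and> certified \<Phi> (procA X Xt T K \<Phi> N)"
  using assms
proof (induction N arbitrary: \<Phi>)
  case 0
  then show ?case by simp
next
  case (Suc N)
  show ?case
  proof (cases N)
    case 0
    then have "\<Phi> \<in> F1_class X Xt K" using Suc.prems by simp
    moreover from this have "regular \<Phi>" by (auto simp: F1_class_def intro: regular_C2)
    ultimately show ?thesis using certified_step0 by (simp add: 0)
  next
    case (Suc M)
    then obtain D where D: "dec K (Suc (Suc M)) \<Phi> = Some D"
      and mem: "\<And>s. s \<in> {1..T} \<Longrightarrow> phi D s \<in> F_class X Xt T K N"
        "\<And>s. s \<in> {1..T} \<Longrightarrow> psi D s \<in> F_class X Xt T K N"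
      and h: "out D \<in> H_class X Xt (inner_fun T D)"
      and \<Phi>: "\<And>x. x \<in> Xt \<Longrightarrow> \<Phi> x = hfun (out D) (inner_fun T D x)"
      using Suc.prems by auto
    define R where "R S \<xi> = (if \<xi> \<in> F_class X Xt T K 1 then step0 K S \<xi> else procA X Xt T K \<xi> N S)"
      for S \<xi>
    have R: "certified \<xi> (\<lambda>S. R S \<xi>)" if "\<xi> \<in> F_class X Xt T K N" for \<xi>
    proof (cases "\<xi> \<in> F_class X Xt T K 1")
      case True
      then show ?thesis using certified_step0[of \<xi> K] by (simp add: R_def)
    next
      case False
      then show ?thesis using Suc.IH[OF that] by (simp add: R_def)
    qed
    have reg: "regular \<xi>" if "\<xi> \<in> F_class X Xt T K N" for \<xi>
      using Suc.IH[OF that] by simp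
    have "procA X Xt T K \<Phi> (Suc N) = (\<lambda>S. compose_step T S D (R S) \<Phi>)"
      unfolding R_def[abs_def] \<open>N = Suc M\<close> by (rule ext) (simp add: D)
    moreover have "certified \<Phi> (\<lambda>S. compose_step T S D (R S) \<Phi>)"
      using reg[OF mem(1)] R[OF mem(1)] reg[OF mem(2)] R[OF mem(2)] h \<Phi>
      by (rule certified_compose_step)
    moreover have "regular (inner_fun T D)"
      using reg[OF mem(1)] reg[OF mem(2)] by (rule regular_inner_fun)
    then have "regular \<Phi>" using h \<Phi> by (rule regular_outer)
    ultimately show ?thesis by simp
  qed
qed

end

theorem theorem1:
  fixes X Xt :: "(real^'n) set" and T N :: nat
    and K :: "(real^'n) knowledge" and \<Phi> :: "real^'n \<Rightarrow> real"
  assumes "bounded X" and "closed X" and "0 \<in> X"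
    and "bounded Xt" and "open Xt" and "X \<subseteq> Xt"
    and "T \<ge> 1" and "N \<ge> 1"
    and "\<Phi> \<in> F_class X Xt T K N"
  shows "(\<forall>S. simplex_collection X Xt S \<longrightarrow>
            margins X S \<Phi> (m_low (procA X Xt T K \<Phi> N S)) (m_up (procA X Xt T K \<Phi> N S)))
       \<and> bigO' X Xt 2 (\<lambda>S. m_low (procA X Xt T K \<Phi> N S))
       \<and> bigO' X Xt 2 (\<lambda>S. m_up (procA X Xt T K \<Phi> N S))"
proof -
  interpret sampled_domain X Xt
    using assms by unfold_locales (auto simp: compact_eq_bounded_closed)
  have cert: "certified \<Phi> (procA X Xt T K \<Phi> N)"
    using certified_procA[OF assms(9)] by simp
  show ?thesis
  proof (intro conjI allI impI bigO'_second_order)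
    show "margins X S \<Phi> (m_low (procA X Xt T K \<Phi> N S)) (m_up (procA X Xt T K \<Phi> N S))"
      if "simplex_collection X Xt S" for S
      using cert that by (simp add: certified_def valid_result_def)
  qed (use cert in \<open>simp_all add: certified_def\<close>)
qed

end
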